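(* Let $\mathbb{K}$ be an algebraically closed field of characteristic different from $2$ and $3$, and let $\alpha_1,\alpha_2,\alpha_3\in\mathbb{K}$. The algebra $\mathcal{T}(\alpha_1,\alpha_2,\alpha_3)$ is semisimple if and only if $$\alpha_3\bigl(\alpha_3+(\alpha_1+\alpha_2)(3\alpha_1-\alpha_2)^2\bigr)\neq 0.$$ In this case $\mathcal{T}(\alpha_1,\alpha_2,\alpha_3)\simeq\left(\mathbb{K}^{6\times 6}\right)^2$ as algebras.
   Context: $\mathcal{T}(\alpha_1,\alpha_2,\alpha_3)$ denotes the associative unital $\mathbb{K}$-algebra given by generators $a,b,c,d$ and relations $$a^2=b^2=c^2=d^2=\alpha_1,$$ $$ca+bc+ab=\alpha_2,\quad da+cd+ac=\alpha_2,\quad db+ba+ad=\alpha_2,\quad dc+cb+bd=\alpha_2,$$ $$(cb+ba+ac-\alpha_2)^3=\alpha_3.$$ $\left(\mathbb{K}^{6\times 6}\right)^2$ is the direct product of two copies of the algebra of $6\times 6$ matrices over $\mathbb{K}$. *)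

theory Defs
  imports
    "HOL-Library.Poly_Mapping"
    "HOL-Computational_Algebra.Polynomial"
    "HOL-Algebra.QuotRing"
    "HOL-Algebra.Generated_Groups"
    "HOL-Algebra.Module"
    "HOL-Algebra.Chinese_Remainder"
    "Jordan_Normal_Form.Matrix"
begin

text \<open>
  An algebra over a field \<open>'k\<close> is represented by a record of type \<open>('k, 'a) module\<close>: a ring
  in the sense of \<open>HOL-Algebra\<close> (not necessarily commutative) together with a scalar
  multiplication by all elements of the type \<open>'k\<close>.
\<close>

subsection \<open>Free algebras\<close>

text \<open>
  The free algebra is the monoid algebra of the free monoid of words. Multiplication on
  \<open>Poly_Mapping\<close> is convolution with respect to \<open>+\<close> on the keys, so concatenation of
  words has to be written additively; a separate type keeps this instance off plain lists.
\<close>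

datatype 'a free_word = Word (letters: "'a list")

instantiation free_word :: (type) monoid_add
begin

definition zero_free_word :: "'a free_word" where "0 = Word []"

definition plus_free_word :: "'a free_word \<Rightarrow> 'a free_word \<Rightarrow> 'a free_word"
  where "v + w = Word (letters v @ letters w)"

instance
  by standard (simp_all add: zero_free_word_def plus_free_word_def)

end

type_synonym ('g, 'k) free_alg = "'g free_word \<Rightarrow>\<^sub>0 'k"

definition free_gen :: "'g \<Rightarrow> ('g, 'k::field) free_alg"
  where "free_gen g = Poly_Mapping.single (Word [g]) 1"

definition free_const :: "'k::field \<Rightarrow> ('g, 'k) free_alg"
  where "free_const r = Poly_Mapping.single 0 r"

definition free_algebra :: "('k::field, ('g, 'k) free_alg) module"
  where "free_algebra =
    \<lparr>carrier = UNIV, mult = (*), one = 1, zero = 0, add = (+),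
     smult = (\<lambda>r x. free_const r * x)\<rparr>"


subsection \<open>Constructions on algebras\<close>

text \<open>
  For a two-sided ideal \<open>I\<close>, scalar multiplication sends the coset \<open>I + x\<close> to \<open>I + r x\<close>;
  the union over representatives follows the pattern of \<open>rcoset_mult\<close>.
\<close>

definition quotient_algebra :: "('k, 'a) module \<Rightarrow> 'a set \<Rightarrow> ('k, 'a set) module"
  where "quotient_algebra A I =
    ring.extend (A Quot I)
      (module.fields (\<lambda>r X. \<Union>x\<in>X. I +>\<^bsub>A\<^esub> (r \<odot>\<^bsub>A\<^esub> x)))"

definition direct_product_algebra ::
    "('k, 'a) module \<Rightarrow> ('k, 'b) module \<Rightarrow> ('k, 'a \<times> 'b) module"
  where "direct_product_algebra A B =
    ring.extend (RDirProd A B)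
      (module.fields (\<lambda>r (x, y). (r \<odot>\<^bsub>A\<^esub> x, r \<odot>\<^bsub>B\<^esub> y)))"

definition matrix_algebra :: "nat \<Rightarrow> ('k::field, 'k mat) module"
  where "matrix_algebra n = ring_mat TYPE('k) n (module.fields (\<cdot>\<^sub>m))"

definition algebra_iso :: "('k, 'a) module \<Rightarrow> ('k, 'b) module \<Rightarrow> ('a \<Rightarrow> 'b) set"
  where "algebra_iso A B =
    {h \<in> ring_iso A B. \<forall>r. \<forall>x\<in>carrier A. h (r \<odot>\<^bsub>A\<^esub> x) = r \<odot>\<^bsub>B\<^esub> h x}"

definition algebras_isomorphic :: "('k, 'a) module \<Rightarrow> ('k, 'b) module \<Rightarrow> bool"
  where "algebras_isomorphic A B \<longleftrightarrow> algebra_iso A B \<noteq> {}"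


subsection \<open>Semisimplicity\<close>

text \<open>
  Left ideals are the submodules of the left regular module. In a unital algebra they are
  automatically closed under scalar multiplication, since \<open>r x = (r 1) x\<close>.
\<close>

definition left_ideal :: "'a set \<Rightarrow> ('a, 'm) ring_scheme \<Rightarrow> bool"
  where "left_ideal L R \<longleftrightarrow>
    additive_subgroup L R \<and> (\<forall>x\<in>carrier R. \<forall>y\<in>L. x \<otimes>\<^bsub>R\<^esub> y \<in> L)"

definition simple_left_ideal :: "'a set \<Rightarrow> ('a, 'm) ring_scheme \<Rightarrow> bool"
  where "simple_left_ideal L R \<longleftrightarrow>
    left_ideal L R \<and> L \<noteq> {\<zero>\<^bsub>R\<^esub>} \<and>
    (\<forall>L'. left_ideal L' R \<and> L' \<subseteq> L \<longrightarrow> L' = {\<zero>\<^bsub>R\<^esub>} \<or> L' = L)"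

text \<open>
  Semisimple: the left regular module is the sum of its simple submodules. The sum of a
  family of submodules is the additive subgroup generated by their union.
\<close>

definition semisimple :: "('a, 'm) ring_scheme \<Rightarrow> bool"
  where "semisimple R \<longleftrightarrow>
    generate (add_monoid R) (\<Union>{L. simple_left_ideal L R}) = carrier R"


subsection \<open>The algebras $\mathcal{T}(\alpha_1,\alpha_2,\alpha_3)$\<close>

datatype tetra_gen = gen_a | gen_b | gen_c | gen_d

text \<open>A relation \<open>u = v\<close> is encoded as the element \<open>u - v\<close> of the free algebra.\<close>

definition T_relations :: "'k::field \<Rightarrow> 'k \<Rightarrow> 'k \<Rightarrow> (tetra_gen, 'k) free_alg set"
  where "T_relations \<alpha>1 \<alpha>2 \<alpha>3 =
    (let a = free_gen gen_a; b = free_gen gen_b; c = free_gen gen_c; d = free_gen gen_d;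
         k1 = free_const \<alpha>1; k2 = free_const \<alpha>2; k3 = free_const \<alpha>3
     in {a^2 - k1, b^2 - k1, c^2 - k1, d^2 - k1,
         c*a + b*c + a*b - k2,
         d*a + c*d + a*c - k2,
         d*b + b*a + a*d - k2,
         d*c + c*b + b*d - k2,
         (c*b + b*a + a*c - k2)^3 - k3})"

definition T_algebra :: "'k::field \<Rightarrow> 'k \<Rightarrow> 'k \<Rightarrow> ('k, (tetra_gen, 'k) free_alg set) module"
  where "T_algebra \<alpha>1 \<alpha>2 \<alpha>3 =
    quotient_algebra free_algebra (Idl\<^bsub>free_algebra\<^esub> (T_relations \<alpha>1 \<alpha>2 \<alpha>3))"

end

theory Submission
  imports "HOL-Analysis.Cartesian_Space" Defs
begin

text \<open>
  Let \<open>z = cb + ba + ac - \<alpha>\<^sub>2\<close> and \<open>s = a + b + c\<close>. The relations give \<open>az = zb\<close>, \<open>bz = zc\<close>, \<open>cz = za\<close>, \<open>dz = zd\<close>,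
  express \<open>s\<^sup>2\<close> and \<open>ds + sd\<close> through \<open>z\<close>, and make \<open>aba - bab\<close> linear; so the 72 elements
  \<open>z\<^sup>k s\<^sup>i d\<^sup>j m\<close> with \<open>k < 3\<close>, \<open>i, j < 2\<close> and \<open>m \<in> {1, a, b, ab, ba, aba}\<close> span the algebra.

  Let \<open>p = \<alpha>\<^sub>1 + \<alpha>\<^sub>2\<close>, \<open>q = 3\<alpha>\<^sub>1 - \<alpha>\<^sub>2\<close> and \<open>\<delta> = \<alpha>\<^sub>3 + p q\<^sup>2\<close>. Over a commutative ring \<open>R\<close> containing the field there is a
  representation by 6 by 6 matrices in which \<open>z\<close> acts as \<open>l diag(1, w, w\<^sup>2)\<close>, where \<open>l\<^sup>3 = \<alpha>\<^sub>3\<close> and \<open>w\<close> is a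
  primitive cube root of unity; it depends on some \<open>x\<close> which, for invertible \<open>l\<close>, can be any solution of \<open>(l x)\<^sup>2 = \<delta>\<close>.
  If \<open>\<alpha>\<^sub>3 \<delta> \<noteq> 0\<close>, take \<open>R = K \<times> K\<close> with the two square roots of \<open>\<delta>\<close>: the image is everything, of
  dimension 72, so the algebra is the product of two matrix algebras. If \<open>\<alpha>\<^sub>3 \<delta> = 0\<close>, take the dual numbers for
  \<open>R\<close>, with \<open>x = \<epsilon>\<close> when \<open>\<alpha>\<^sub>3 \<noteq> 0\<close> and \<open>l = \<epsilon>\<close> when \<open>\<alpha>\<^sub>3 = 0 \<noteq> q\<close>: the image contains a nonzero multiple
  \<open>\<epsilon> u\<close>, and \<open>(\<epsilon> u) r (\<epsilon> u) = 0\<close> for all \<open>r\<close> is impossible in an image of a semisimple ring. The case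
  \<open>\<alpha>\<^sub>3 = q = 0\<close> has a triangular two-dimensional representation with the same effect.
\<close>

section \<open>Small matrix rings\<close>

text \<open>Entries may come from a noncommutative ring, so that \<open>'r mat2 mat3\<close> is
  again a ring: the 6 by 6 matrices over \<open>'r\<close>, cut into nine 2 by 2 blocks.\<close>

datatype 'r mat2 = Mat2 (e11: 'r) (e12: 'r) (e21: 'r) (e22: 'r)

instantiation mat2 :: (ring_1) ring_1
begin
definition "0 = Mat2 0 0 0 0"
definition "1 = Mat2 1 0 0 1"
definition "A + B = Mat2 (e11 A + e11 B) (e12 A + e12 B) (e21 A + e21 B) (e22 A + e22 B)"
definition "A - B = Mat2 (e11 A - e11 B) (e12 A - e12 B) (e21 A - e21 B) (e22 A - e22 B)"
definition "- A = Mat2 (- e11 A) (- e12 A) (- e21 A) (- e22 A)" for A :: "'a mat2"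
definition "A * B = Mat2
  (e11 A * e11 B + e12 A * e21 B) (e11 A * e12 B + e12 A * e22 B)
  (e21 A * e11 B + e22 A * e21 B) (e21 A * e12 B + e22 A * e22 B)"
lemmas mat2_defs = zero_mat2_def one_mat2_def plus_mat2_def minus_mat2_def uminus_mat2_def times_mat2_def
instance by standard (auto simp: mat2_defs algebra_simps mat2.expand)
end

lemma mat2_simps [simp]:
  "e11 0 = 0" "e12 0 = 0" "e21 0 = 0" "e22 0 = 0"
  "e11 1 = 1" "e12 1 = 0" "e21 1 = 0" "e22 1 = 1"
  "Mat2 a b c d + Mat2 a' b' c' d' = Mat2 (a + a') (b + b') (c + c') (d + d')"
  "Mat2 a b c d - Mat2 a' b' c' d' = Mat2 (a - a') (b - b') (c - c') (d - d')"
  "- Mat2 a b c d = Mat2 (- a) (- b) (- c) (- d)"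
  "Mat2 a b c d * Mat2 a' b' c' d' =
    Mat2 (a * a' + b * c') (a * b' + b * d') (c * a' + d * c') (c * b' + d * d')"
  by (simp_all add: mat2_defs)

datatype 'r mat3 = Mat3 (f11: 'r) (f12: 'r) (f13: 'r) (f21: 'r) (f22: 'r) (f23: 'r) (f31: 'r) (f32: 'r) (f33: 'r)

instantiation mat3 :: (ring_1) ring_1
begin
definition "0 = Mat3 0 0 0 0 0 0 0 0 0"
definition "1 = Mat3 1 0 0 0 1 0 0 0 1"
definition "A + B = Mat3 (f11 A + f11 B) (f12 A + f12 B) (f13 A + f13 B)
  (f21 A + f21 B) (f22 A + f22 B) (f23 A + f23 B) (f31 A + f31 B) (f32 A + f32 B) (f33 A + f33 B)"
definition "A - B = Mat3 (f11 A - f11 B) (f12 A - f12 B) (f13 A - f13 B)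
  (f21 A - f21 B) (f22 A - f22 B) (f23 A - f23 B) (f31 A - f31 B) (f32 A - f32 B) (f33 A - f33 B)"
definition "- A = Mat3 (- f11 A) (- f12 A) (- f13 A) (- f21 A) (- f22 A) (- f23 A)
  (- f31 A) (- f32 A) (- f33 A)" for A :: "'a mat3"
definition "A * B = Mat3
  (f11 A * f11 B + f12 A * f21 B + f13 A * f31 B)
  (f11 A * f12 B + f12 A * f22 B + f13 A * f32 B)
  (f11 A * f13 B + f12 A * f23 B + f13 A * f33 B)
  (f21 A * f11 B + f22 A * f21 B + f23 A * f31 B)
  (f21 A * f12 B + f22 A * f22 B + f23 A * f32 B)
  (f21 A * f13 B + f22 A * f23 B + f23 A * f33 B)
  (f31 A * f11 B + f32 A * f21 B + f33 A * f31 B)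
  (f31 A * f12 B + f32 A * f22 B + f33 A * f32 B)
  (f31 A * f13 B + f32 A * f23 B + f33 A * f33 B)"
lemmas mat3_defs = zero_mat3_def one_mat3_def plus_mat3_def minus_mat3_def uminus_mat3_def times_mat3_def
instance by standard (auto simp: mat3_defs algebra_simps mat3.expand)
end

lemma mat3_simps [simp]:
  "Mat3 a b c d e f g h i + Mat3 a' b' c' d' e' f' g' h' i' =
    Mat3 (a + a') (b + b') (c + c') (d + d') (e + e') (f + f') (g + g') (h + h') (i + i')"
  "Mat3 a b c d e f g h i - Mat3 a' b' c' d' e' f' g' h' i' =
    Mat3 (a - a') (b - b') (c - c') (d - d') (e - e') (f - f') (g - g') (h - h') (i - i')"
  "- Mat3 a b c d e f g h i = Mat3 (- a) (- b) (- c) (- d) (- e) (- f) (- g) (- h) (- i)"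
  "Mat3 a b c d e f g h i * Mat3 a' b' c' d' e' f' g' h' i' =
    Mat3 (a * a' + b * d' + c * g') (a * b' + b * e' + c * h') (a * c' + b * f' + c * i')
         (d * a' + e * d' + f * g') (d * b' + e * e' + f * h') (d * c' + e * f' + f * i')
         (g * a' + h * d' + i * g') (g * b' + h * e' + i * h') (g * c' + h * f' + i * i')"
  by (simp_all add: mat3_defs)

section \<open>Coefficient rings: pairs and dual numbers\<close>

datatype 'k split = Split (fst_s: 'k) (snd_s: 'k)

instantiation split :: (comm_ring_1) comm_ring_1
begin
definition "0 = Split 0 0"
definition "1 = Split 1 1"
definition "A + B = Split (fst_s A + fst_s B) (snd_s A + snd_s B)"
definition "A - B = Split (fst_s A - fst_s B) (snd_s A - snd_s B)"
definition "- A = Split (- fst_s A) (- snd_s A)" for A :: "'a split"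
definition "A * B = Split (fst_s A * fst_s B) (snd_s A * snd_s B)"
lemmas split_defs = zero_split_def one_split_def plus_split_def minus_split_def uminus_split_def times_split_def
instance by standard (auto simp: split_defs algebra_simps split.expand)
end

datatype 'k dual = Dual (re_d: 'k) (eps_d: 'k)

instantiation dual :: (comm_ring_1) comm_ring_1
begin
definition "0 = Dual 0 0"
definition "1 = Dual 1 0"
definition "A + B = Dual (re_d A + re_d B) (eps_d A + eps_d B)"
definition "A - B = Dual (re_d A - re_d B) (eps_d A - eps_d B)"
definition "- A = Dual (- re_d A) (- eps_d A)" for A :: "'a dual"
definition "A * B = Dual (re_d A * re_d B) (re_d A * eps_d B + eps_d A * re_d B)"
lemmas dual_defs = zero_dual_def one_dual_def plus_dual_def minus_dual_def uminus_dual_def times_dual_def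
instance by standard (auto simp: dual_defs algebra_simps dual.expand)
end

text \<open>Scalars act as these central matrices, so that a ring homomorphism into the centre can
  play the role of an algebra structure.\<close>

definition scal :: "'r::comm_ring_1 \<Rightarrow> 'r mat2 mat3" where
  "scal r = Mat3 (Mat2 r 0 0 r) 0 0 0 (Mat2 r 0 0 r) 0 0 0 (Mat2 r 0 0 r)"

lemma scal_mult_left [simp]: "scal r * Mat3 a b c d e f g h i =
  (let m = Mat2 r 0 0 r in Mat3 (m*a) (m*b) (m*c) (m*d) (m*e) (m*f) (m*g) (m*h) (m*i))"
  by (simp add: scal_def Let_def)

lemma scal_central: "M * scal r = scal r * M"
proof -
  have c: "X * Mat2 r 0 0 r = Mat2 r 0 0 r * X" for X
    by (cases X) (simp add: mult.commute)
  show ?thesis by (cases M) (simp add: scal_def c)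
qed

lemma scal_hom: "scal (r + t) = scal r + scal t" "scal (r * t) = scal r * scal t"
  "scal 1 = 1" "scal 0 = 0" "scal (- r) = - scal r" "scal (r - t) = scal r - scal t"
  by (simp_all add: scal_def zero_mat3_def one_mat3_def zero_mat2_def one_mat2_def)

section \<open>A six-dimensional representation over a commutative ring\<close>

text \<open>
  Put \<open>S = [[x, y], [-q, -x]]\<close>, \<open>n = [[0, 1], [0, 0]]\<close>, \<open>\<tau> = [[t, v], [l, -t]]\<close>. The assumptions say that
  \<open>S\<^sup>2 = l\<close>, \<open>\<tau>\<^sup>2 = p\<close> and \<open>S \<tau> + \<tau> S = 0\<close>; moreover \<open>S n + n S = -q\<close> and \<open>\<tau> n + n \<tau> = l\<close>. Below
  \<open>H\<^sub>i = w\<^sup>-\<^sup>i S - w\<^sup>i n\<close>, with \<open>w\<^sup>2\<close> written as \<open>-1 - w\<close>, and \<open>A\<close>, \<open>B\<close>, \<open>C\<close>, \<open>D\<close> are six times the images of the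
  generators, which avoids fractions. \<open>A\<close>, \<open>C\<close>, \<open>B\<close> are successive conjugates under
  \<open>diag(1, w, w\<^sup>2)\<close>, and \<open>Z\<close> is the image of \<open>cb + ba + ac - \<alpha>\<^sub>2\<close>.
\<close>

locale tetra_rep =
  fixes w x y t v l q p :: "'r::comm_ring_1"
  assumes w: "w * w = - 1 - w"
    and xx: "x * x = y * q + l"
    and tt: "t * t = p - l * v"
    and ly: "l * y = q * v - 2 * x * t"
begin

definition "tau = Mat2 t v l (- t)"
definition "H0 = Mat2 x (y - 1) (- q) (- x)"
definition "H1 = Mat2 (- x - w * x) (- y - w * y - w) (q + w * q) (x + w * x)"
definition "H2 = Mat2 (w * x) (w * y + 1 + w) (- w * q) (- w * x)"

definition "A = Mat3 (3*tau - H0) (2*H2) (2*H1) (2*H2) (3*tau - H1) (2*H0) (2*H1) (2*H0) (3*tau - H2)"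
definition "W = Mat2 w 0 0 w"
definition "V = Mat2 (- 1 - w) 0 0 (- 1 - w)"
definition "B = Mat3 (3*tau - H0) (W*2*H2) (V*2*H1) (V*2*H2) (3*tau - H1) (W*2*H0) (W*2*H1) (V*2*H0) (3*tau - H2)"
definition "C = Mat3 (3*tau - H0) (V*2*H2) (W*2*H1) (W*2*H2) (3*tau - H1) (V*2*H0) (V*2*H1) (W*2*H0) (3*tau - H2)"
definition "D = Mat3 (3*tau + 3*H0) 0 0 0 (3*tau + 3*H1) 0 0 0 (3*tau + 3*H2)"
definition "Z = Mat3 (Mat2 l 0 0 l) 0 0 0 (Mat2 (w * l) 0 0 (w * l)) 0 0 0 (Mat2 (-l - w * l) 0 0 (-l - w * l))"

lemma numeral_mat2: "(2::'r mat2) = Mat2 2 0 0 2" "(3::'r mat2) = Mat2 3 0 0 3"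
proof -
  show "(2::'r mat2) = Mat2 2 0 0 2"
    unfolding one_add_one[symmetric] by (simp add: one_mat2_def)
  have "(3::'r mat2) = 1 + 1 + 1" by simp
  also have "\<dots> = Mat2 3 0 0 3" unfolding one_mat2_def mat2_simps by simp
  finally show "(3::'r mat2) = Mat2 3 0 0 3" .
qed

text \<open>Each relation is repeated with a trailing factor \<open>r\<close>: in products nested to
  the right, the two factors to be rewritten are usually followed by others.\<close>

lemma w': "w * (w * r) = - r - w * r"
  unfolding mult.assoc[symmetric] w by (simp add: algebra_simps)
lemma xx': "x * (x * r) = y * (q * r) + l * r"
  unfolding mult.assoc[symmetric] xx by (simp add: algebra_simps)
lemma tt': "t * (t * r) = p * r - l * (v * r)"
  unfolding mult.assoc[symmetric] tt by (simp add: algebra_simps)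
lemma ly': "l * (y * r) = q * (v * r) - 2 * (x * (t * r))"
  unfolding mult.assoc[symmetric] ly by (simp add: algebra_simps)

text \<open>The copies with a factor \<open>w\<close> are needed because sorting the factors moves \<open>w\<close> between \<open>l\<close> and \<open>y\<close>.\<close>

lemma lwy: "l * (w * y) = q * (v * w) - 2 * (t * (w * x))"
  using arg_cong[OF ly, of "\<lambda>z. w * z"] by (simp add: algebra_simps)
lemma lwy': "l * (w * (y * r)) = q * (v * (w * r)) - 2 * (t * (w * (x * r)))"
  using arg_cong[OF lwy, of "\<lambda>z. z * r"] by (simp add: algebra_simps)

lemmas block_defs = tau_def H0_def H1_def H2_def
lemmas gen_defs = numeral_mat2 zero_mat2_def scal_def W_def V_def A_def B_def C_def D_def Z_def block_defs

section \<open>The matrices satisfy the defining relations, up to the factor 36\<close>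

lemma A_squared: "A * A = scal (9 * (p + q))"
  by (simp add: gen_defs algebra_simps w w' xx xx' tt tt' ly ly' lwy lwy')
text \<open>Since \<open>w^3 = 1\<close>, conjugation by \<open>diag(1, w, w^2)\<close> is
  available; it maps \<open>A\<close> to \<open>C\<close>, \<open>C\<close> to \<open>B\<close> and
  \<open>B\<close> to \<open>A\<close>, so the three squares agree.\<close>

lemma B_squared: "B * B = scal (9 * (p + q))"
  by (simp add: gen_defs algebra_simps w w' xx xx' tt tt' ly ly' lwy lwy')
lemma C_squared: "C * C = scal (9 * (p + q))"
  by (simp add: gen_defs algebra_simps w w' xx xx' tt tt' ly ly' lwy lwy')
text \<open>\<open>H\<^sub>i^2 = q + w^i l\<close> and
  \<open>tau H\<^sub>i + H\<^sub>i tau = - w^i l\<close>, so the terms with \<open>l\<close> cancel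
  in \<open>(tau + H\<^sub>i)^2\<close>.\<close>

lemma D_squared: "D * D = scal (9 * (p + q))"
  by (simp add: gen_defs algebra_simps w w' xx xx' tt tt' ly ly' lwy lwy')
lemma rel_ABC: "C * A + B * C + A * B = scal (9 * (3 * p - q))"
  by (simp add: gen_defs algebra_simps w w' xx xx' tt tt' ly ly' lwy lwy')
text \<open>This relation and the next two are permuted by the conjugation above, which fixes the
  block diagonal \<open>D\<close>.\<close>

lemma rel_ACD: "D * A + C * D + A * C = scal (9 * (3 * p - q))"
  by (simp add: gen_defs algebra_simps w w' xx xx' tt tt' ly ly' lwy lwy')
lemma rel_ABD: "D * B + B * A + A * D = scal (9 * (3 * p - q))"
  by (simp add: gen_defs algebra_simps w w' xx xx' tt tt' ly ly' lwy lwy')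
lemma rel_BCD: "D * C + C * B + B * D = scal (9 * (3 * p - q))"
  by (simp add: gen_defs algebra_simps w w' xx xx' tt tt' ly ly' lwy lwy')
lemma rel_Z: "C * B + B * A + A * C = scal (9 * (3 * p - q)) + scal 36 * Z"
  by (simp add: gen_defs algebra_simps w w' xx xx' tt tt' ly ly' lwy lwy')
lemma Z_cubed: "Z * (Z * Z) = scal (l * (l * l))"
  by (simp add: gen_defs algebra_simps w w')
end

section \<open>Evaluation of free algebra elements\<close>

lemma free_alg_induct [case_names single add]:
  fixes f :: "('g, 'k::field) free_alg"
  assumes "\<And>w c. P (Poly_Mapping.single w c)" and "\<And>f g. P f \<Longrightarrow> P g \<Longrightarrow> P (f + g)"
  shows "P f"
proof (induction f rule: Poly_Mapping.update_induct)
  case const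
  show ?case using assms(1)[of 0 0] by simp
next
  case (update f a b)
  \<comment> \<open>The key \<open>a\<close> lies outside the support of \<open>f\<close>, so
    overwriting its value 0 amounts to adding a monomial.\<close>
  have "Poly_Mapping.update a b f = f + Poly_Mapping.single a b"
    using update(1) by (intro poly_mapping_eqI)
      (auto simp: lookup_update lookup_add lookup_single in_keys_iff when_def)
  then show ?case using update assms by metis
qed

text \<open>Every monomial is reached from a constant by appending generators on the right. This
  fits sets known to be closed under right multiplication by generators.\<close>

lemma free_alg_gen_induct [case_names const gen add]:
  fixes f :: "('g, 'k::field) free_alg"
  assumes "\<And>c. P (free_const c)" and "\<And>f g. P f \<Longrightarrow> P (f * free_gen g)"
    and "\<And>f g. P f \<Longrightarrow> P g \<Longrightarrow> P (f + g)"
  shows "P f"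
proof (induction f rule: free_alg_induct)
  case (single w c)
  show ?case
  proof (cases w)
    case (Word xs)
    have "P (Poly_Mapping.single (Word xs) c)"
    proof (induction xs rule: rev_induct)
      case Nil
      then show ?case using assms(1)[of c] by (simp add: free_const_def zero_free_word_def)
    next
      case (snoc x xs)
      have "Poly_Mapping.single (Word (xs @ [x])) c = Poly_Mapping.single (Word xs) c * free_gen x"
        by (simp add: free_gen_def mult_single plus_free_word_def)
      then show ?case using assms(2)[OF snoc] by simp
    qed
    then show ?thesis by (simp add: Word)
  qed
next
  case (add f g)
  then show ?case using assms(3) by blast
qed

lemma free_const_central: "f * free_const r = free_const r * f"
  by (induction f rule: free_alg_induct)
     (simp_all add: free_const_def mult_single mult.commute ring_distribs)

lemma free_const_hom: "free_const (r + s) = free_const r + free_const s"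
  "free_const (r * s) = free_const r * free_const s" "free_const 1 = 1" "free_const 0 = 0"
  "free_const (- r) = - free_const r" "free_const (r - s) = free_const r - free_const s"
  by (simp_all add: free_const_def single_add mult_single single_uminus single_diff)

text \<open>The homomorphism that the universal property of the free algebra attaches to
  \<open>g\<close>, with \<open>e\<close> as the structure map on scalars.\<close>

definition word_eval :: "('k::field \<Rightarrow> 'r::ring_1) \<Rightarrow> ('g \<Rightarrow> 'r) \<Rightarrow> ('g, 'k) free_alg \<Rightarrow> 'r" where
  "word_eval e g f = (\<Sum>w\<in>Poly_Mapping.keys f. e (Poly_Mapping.lookup f w) * prod_list (map g (letters w)))"

locale evaluation =
  fixes e :: "'k::field \<Rightarrow> 'r::ring_1" and g :: "'g \<Rightarrow> 'r"
  assumes e_add: "e (a + b) = e a + e b" and e_mult: "e (a * b) = e a * e b" and e_one: "e 1 = 1"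
    and e_central: "r * e a = e a * r"
begin

abbreviation "ev \<equiv> word_eval e g"

lemma e_zero [simp]: "e 0 = 0"
  using e_add[of 0 0] by simp

lemma ev_add: "ev (f + h) = ev f + ev h"
  unfolding word_eval_def by (rule setsum_keys_plus_distrib) (simp_all add: e_add distrib_right)

lemma ev_single: "ev (Poly_Mapping.single w c) = e c * prod_list (map g (letters w))"
  by (simp add: word_eval_def)

text \<open>Additivity in both factors reduces this to monomials; there the scalar of the second
  passes through the word of the first because the values of \<open>e\<close> are central.\<close>

lemma ev_mult: "ev (f * h) = ev f * ev h"
proof (induction f rule: free_alg_induct)
  case (single w c)
  show ?case
  proof (induction h rule: free_alg_induct)
    case (single v d)
    have "e c * e d * (X * Y) = e c * X * (e d * Y)" for X Y
      by (metis e_central mult.assoc)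
    then show ?case by (simp add: mult_single ev_single plus_free_word_def e_mult)
  qed (simp add: distrib_left ev_add)
qed (simp add: distrib_right ev_add)

lemma ev_const: "ev (free_const r) = e r"
  by (simp add: free_const_def ev_single zero_free_word_def)

lemma ev_gen: "ev (free_gen x) = g x"
  by (simp add: free_gen_def ev_single e_one)

lemma ev_one: "ev 1 = 1"
  using ev_const[of 1] by (simp add: free_const_hom e_one)

lemma ev_zero: "ev 0 = 0"
  using ev_const[of 0] by (simp add: free_const_hom)

lemma ev_minus: "ev (- f) = - ev f"
  using ev_add[of f "- f"] by (simp add: ev_zero eq_neg_iff_add_eq_0 add.commute)

lemma ev_diff: "ev (f - h) = ev f - ev h"
  using ev_add[of f "- h"] ev_minus by simp

lemma ev_power: "ev (f ^ n) = ev f ^ n"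
  by (induction n) (simp_all add: ev_one ev_mult)

lemmas ev_simps = ev_add ev_mult ev_const ev_gen ev_one ev_zero ev_minus ev_diff ev_power

end

section \<open>The free algebra as a ring, and its ideals\<close>

lemma free_algebra_simps [simp]:
  "carrier free_algebra = UNIV" "x \<otimes>\<^bsub>free_algebra\<^esub> y = x * y" "x \<oplus>\<^bsub>free_algebra\<^esub> y = x + y"
  "\<one>\<^bsub>free_algebra\<^esub> = 1" "\<zero>\<^bsub>free_algebra\<^esub> = 0" "r \<odot>\<^bsub>free_algebra\<^esub> x = free_const r * x"
  by (simp_all add: free_algebra_def)

interpretation free_algebra: ring "free_algebra :: ('k::field, ('g, 'k) free_alg) module"
proof (rule ringI)
  show "abelian_group (free_algebra :: ('k::field, ('g, 'k) free_alg) module)"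
    by (rule abelian_groupI) (auto simp: add.assoc add.commute intro: exI[of _ "- x" for x])
  show "Group.monoid (free_algebra :: ('k::field, ('g, 'k) free_alg) module)"
    by (rule monoidI) (auto simp: mult.assoc)
qed (auto simp: distrib_left distrib_right)

lemma ideal_free_algebraD:
  assumes "ideal I (free_algebra :: ('k::field, ('g, 'k) free_alg) module)"
  shows "0 \<in> I" "x \<in> I \<Longrightarrow> y \<in> I \<Longrightarrow> x + y \<in> I" "x \<in> I \<Longrightarrow> r * x \<in> I" "x \<in> I \<Longrightarrow> x * r \<in> I"
    "x \<in> I \<Longrightarrow> - x \<in> I" "x \<in> I \<Longrightarrow> y \<in> I \<Longrightarrow> x - y \<in> I"
proof -
  interpret ideal I "free_algebra :: ('k, ('g, 'k) free_alg) module" by fact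
  show 0: "0 \<in> I" and a: "\<And>x y. x \<in> I \<Longrightarrow> y \<in> I \<Longrightarrow> x + y \<in> I"
    using zero_closed a_closed by simp_all
  show l: "\<And>x r. x \<in> I \<Longrightarrow> r * x \<in> I" and "x \<in> I \<Longrightarrow> x * r \<in> I"
    using I_l_closed I_r_closed by simp_all
  have m: "\<And>x. x \<in> I \<Longrightarrow> - x \<in> I" using l[of _ "- 1"] by simp
  then show "x \<in> I \<Longrightarrow> - x \<in> I" .
  show "x \<in> I \<Longrightarrow> y \<in> I \<Longrightarrow> x - y \<in> I" using a[of x "- y"] m[of y] by simp
qed

lemma ideal_free_algebraI:
  fixes I :: "('g, 'k::field) free_alg set"
  assumes "0 \<in> I" "\<And>x y. x \<in> I \<Longrightarrow> y \<in> I \<Longrightarrow> x + y \<in> I" "\<And>x r. x \<in> I \<Longrightarrow> r * x \<in> I"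
    "\<And>x r. x \<in> I \<Longrightarrow> x * r \<in> I"
  shows "ideal I free_algebra"
proof (rule idealI)
  show "ring (free_algebra :: ('k::field, ('g, 'k) free_alg) module)" by (rule free_algebra.ring_axioms)
  have m: "\<And>x. x \<in> I \<Longrightarrow> - x \<in> I" using assms(3)[of _ "- 1"] by simp
  show "subgroup I (add_monoid (free_algebra :: ('k, ('g, 'k) free_alg) module))"
  proof (rule group.subgroupI)
    show "Group.group (add_monoid (free_algebra :: ('k, ('g, 'k) free_alg) module))"
      by (rule free_algebra.a_group)
    fix a assume "a \<in> I"
    have "inv\<^bsub>add_monoid free_algebra\<^esub> a = - a"
      using free_algebra.minus_equality[of "- a" a] by (simp add: a_inv_def)
    then show "inv\<^bsub>add_monoid free_algebra\<^esub> a \<in> I" using m[OF \<open>a \<in> I\<close>] by simp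
  qed (use assms in auto)
qed (use assms in auto)

lemma (in evaluation) ideal_kernel: "ideal {f. ev f = 0} free_algebra"
  by (rule ideal_free_algebraI) (simp_all add: ev_simps)

section \<open>A spanning set with 72 elements\<close>

text \<open>The computations take place above the quotient: \<open>I\<close> is a two-sided ideal
  containing the relators, \<open>K\<close> supplies the scalars, and congruence modulo
  \<open>I\<close> replaces equality of cosets.\<close>

locale tetra_relations =
  fixes I :: "'r::ring_1 set" and K :: "'k::field \<Rightarrow> 'r" and k1 k2 k3 :: 'k and a b c d :: 'r
  assumes K_one: "K 1 = 1" and K_add: "K (t + u) = K t + K u"
    and K_mult: "K (t * u) = K t * K u" and I_zero: "0 \<in> I" and I_add: "x \<in> I \<Longrightarrow> y \<in> I \<Longrightarrow> x + y \<in> I"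
    and I_left: "x \<in> I \<Longrightarrow> r * x \<in> I" and I_right: "x \<in> I \<Longrightarrow> x * r \<in> I"
    and K_central: "r * K t = K t * r"
    and aa: "a * a - K k1 \<in> I" and bb: "b * b - K k1 \<in> I" and cc: "c * c - K k1 \<in> I"
    and dd: "d * d - K k1 \<in> I"
    and rel_abc: "c * a + b * c + a * b - K k2 \<in> I"
    and rel_acd: "d * a + c * d + a * c - K k2 \<in> I"
    and rel_abd: "d * b + b * a + a * d - K k2 \<in> I"
    and rel_bcd: "d * c + c * b + b * d - K k2 \<in> I"
    and rel_cube: "(c * b + b * a + a * c - K k2) ^ 3 - K k3 \<in> I"
begin

lemma K_zero: "K 0 = 0" using K_add[of 0 0] by simp
lemma K_minus_one: "K (- 1) = - 1"
  using K_add[of 1 "- 1"] K_zero K_one by (simp add: eq_neg_iff_add_eq_0 add.commute)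

definition eqv (infix "\<approx>" 50) where "x \<approx> y \<longleftrightarrow> x - y \<in> I"

lemma I_minus: "x \<in> I \<Longrightarrow> - x \<in> I" using I_left[of x "- 1"] by simp
lemma I_diff: "x \<in> I \<Longrightarrow> y \<in> I \<Longrightarrow> x - y \<in> I" using I_add[of x "- y"] I_minus by simp

lemma eqv_refl [simp, intro]: "x \<approx> x" by (simp add: eqv_def I_zero)
lemma eqv_sym: "x \<approx> y \<Longrightarrow> y \<approx> x" using I_minus unfolding eqv_def by fastforce
lemma eqv_trans [trans]: "x \<approx> y \<Longrightarrow> y \<approx> w \<Longrightarrow> x \<approx> w"
  using I_add[of "x - y" "y - w"] by (simp add: eqv_def)
lemma eqv_add: "x \<approx> y \<Longrightarrow> x' \<approx> y' \<Longrightarrow> x + x' \<approx> y + y'"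
  using I_add[of "x - y" "x' - y'"] by (simp add: eqv_def algebra_simps)
lemma eqv_diff: "x \<approx> y \<Longrightarrow> x' \<approx> y' \<Longrightarrow> x - x' \<approx> y - y'"
  using I_diff[of "x - y" "x' - y'"] by (simp add: eqv_def algebra_simps)
lemma eqv_left: "x \<approx> y \<Longrightarrow> r * x \<approx> r * y"
  using I_left[of "x - y" r] by (simp add: eqv_def algebra_simps)
lemma eqv_right: "x \<approx> y \<Longrightarrow> x * r \<approx> y * r"
  using I_right[of "x - y" r] by (simp add: eqv_def algebra_simps)

definition "s = a + b + c"
definition "z = c * b + b * a + a * c - K k2"

lemma K_left: "r * (K t * q) = K t * (r * q)"
  by (metis K_central mult.assoc)

lemmas K_rules = K_central[of a] K_central[of b] K_central[of c] K_central[of d] K_central[of s] K_central[of z]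
  K_left[of a] K_left[of b] K_left[of c] K_left[of d] K_left[of s] K_left[of z]

text \<open>Subtract the relator of \<open>ca + bc + ab\<close> times \<open>a\<close> from
  \<open>b\<close> times that relator: \<open>bca\<close> cancels, and the squares contribute
  \<open>k1 c\<close> with opposite signs. The relator is invariant under the cyclic shift of
  \<open>a\<close>, \<open>b\<close>, \<open>c\<close>, which gives the two analogues below.\<close>

lemma braid_ab: "b * (a * b) \<approx> a * (b * a) + K k2 * b - K k2 * a"
proof -
  have "b * (a * b) - (a * (b * a) + K k2 * b - K k2 * a)
    = b * (c * a + b * c + a * b - K k2) - (c * a + b * c + a * b - K k2) * a
      - (b * b - K k1) * c + c * (a * a - K k1)"
    by (simp add: algebra_simps K_rules)
  then show ?thesis unfolding eqv_def by (metis I_add I_diff I_left I_right aa bb rel_abc)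
qed

lemma braid_bc: "c * (b * c) \<approx> b * (c * b) + K k2 * c - K k2 * b"
proof -
  have "c * (b * c) - (b * (c * b) + K k2 * c - K k2 * b)
    = c * (c * a + b * c + a * b - K k2) - (c * a + b * c + a * b - K k2) * b
      - (c * c - K k1) * a + a * (b * b - K k1)"
    by (simp add: algebra_simps K_rules)
  then show ?thesis unfolding eqv_def by (metis I_add I_diff I_left I_right bb cc rel_abc)
qed

lemma braid_ca: "a * (c * a) \<approx> c * (a * c) + K k2 * a - K k2 * c"
proof -
  have "a * (c * a) - (c * (a * c) + K k2 * a - K k2 * c)
    = a * (c * a + b * c + a * b - K k2) - (c * a + b * c + a * b - K k2) * c
      - (a * a - K k1) * b + b * (c * c - K k1)"
    by (simp add: algebra_simps K_rules)
  then show ?thesis unfolding eqv_def by (metis I_add I_diff I_left I_right aa cc rel_abc)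
qed

text \<open>In \<open>az - zb\<close> the words \<open>acb\<close> cancel, \<open>aac\<close> and
  \<open>cbb\<close> both reduce to \<open>k1 c\<close>, and the rest is the braid relation. As
  \<open>z\<close> is invariant under the cyclic shift, the next two rules follow the same
  pattern.\<close>

lemma az: "a * z \<approx> z * b"
proof -
  have "a * z - z * b = (a * a - K k1) * c - c * (b * b - K k1)
      - (b * (a * b) - (a * (b * a) + K k2 * b - K k2 * a))"
    by (simp add: z_def algebra_simps K_rules)
  then show ?thesis using braid_ab unfolding eqv_def by (metis I_diff I_left I_right aa bb)
qed

lemma bz: "b * z \<approx> z * c"
proof -
  have "b * z - z * c = (b * b - K k1) * a - a * (c * c - K k1)
      - (c * (b * c) - (b * (c * b) + K k2 * c - K k2 * b))"
    by (simp add: z_def algebra_simps K_rules)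
  then show ?thesis using braid_bc unfolding eqv_def by (metis I_diff I_left I_right bb cc)
qed

lemma cz: "c * z \<approx> z * a"
proof -
  have "c * z - z * a = (c * c - K k1) * b - b * (a * a - K k1)
      - (a * (c * a) - (c * (a * c) + K k2 * a - K k2 * c))"
    by (simp add: z_def algebra_simps K_rules)
  then show ?thesis using braid_ca unfolding eqv_def by (metis I_diff I_left I_right aa cc)
qed

lemma I_commutator: "x \<in> I \<Longrightarrow> r * x - x * r \<in> I"
  by (intro I_diff I_left[of x r] I_right[of x r])

text \<open>The three relations containing \<open>d\<close> add up to
  \<open>ds + sd + z = 2 k2\<close>. Taking the commutator with \<open>d\<close> leaves that of
  \<open>d\<close> and \<open>z\<close> plus that of \<open>d^2\<close> and \<open>s\<close>, and
  \<open>d^2\<close> is a scalar.\<close>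

lemma dz: "d * z \<approx> z * d"
proof -
  have "d * z - z * d =
      (d * (d * a + c * d + a * c - K k2) - (d * a + c * d + a * c - K k2) * d)
    + (d * (d * b + b * a + a * d - K k2) - (d * b + b * a + a * d - K k2) * d)
    + (d * (d * c + c * b + b * d - K k2) - (d * c + c * b + b * d - K k2) * d)
    + (s * (d * d - K k1) - (d * d - K k1) * s)"
    by (simp add: z_def s_def algebra_simps K_rules)
  also have "\<dots> \<in> I"
    by (rule I_add I_commutator rel_acd rel_abd rel_bcd dd)+
  finally show ?thesis by (simp add: eqv_def)
qed

text \<open>By the rules above \<open>z\<close> permutes \<open>a\<close>, \<open>b\<close>,
  \<open>c\<close> cyclically, so it commutes with their sum.\<close>

lemma sz: "s * z \<approx> z * s"
  using eqv_add[OF eqv_add[OF az bz] cz] by (simp add: s_def algebra_simps)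

lemma ss: "s * s \<approx> K k1 + K k1 + K k1 + K k2 + K k2 + z"
proof -
  have "s * s - (K k1 + K k1 + K k1 + K k2 + K k2 + z) = (a * a - K k1) + (b * b - K k1) + (c * c - K k1)
      + (c * a + b * c + a * b - K k2)"
    by (simp add: z_def s_def algebra_simps)
  then show ?thesis using I_add[OF I_add[OF I_add[OF aa bb] cc] rel_abc] unfolding eqv_def by (simp only:)
qed

lemma ds: "d * s \<approx> K k2 + K k2 - z - s * d"
proof -
  have "d * s - (K k2 + K k2 - z - s * d) = (d * a + c * d + a * c - K k2)
      + (d * b + b * a + a * d - K k2) + (d * c + c * b + b * d - K k2)"
    by (simp add: z_def s_def algebra_simps)
  then show ?thesis using I_add[OF I_add[OF rel_acd rel_abd] rel_bcd] unfolding eqv_def by (simp only:)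
qed

lemma zzz: "z * (z * z) \<approx> K k3"
  using rel_cube by (simp add: eqv_def z_def power3_eq_cube mult.assoc)

text \<open>Together with \<open>bc\<close> below, this trades a final \<open>c\<close> for left
  factors \<open>z\<close> and \<open>s\<close> and words in \<open>a\<close> and
  \<open>b\<close>.\<close>

lemma ac: "a * c \<approx> K k1 + K k2 + z - s * b + a * b - b * a"
proof -
  have "a * c - (K k1 + K k2 + z - s * b + a * b - b * a) = (b * b - K k1)"
    by (simp add: z_def s_def algebra_simps)
  then show ?thesis using bb unfolding eqv_def by (simp only:)
qed

lemma bc: "b * c \<approx> K k1 + K k2 - a * b - s * a + b * a"
proof -
  have "b * c - (K k1 + K k2 - a * b - s * a + b * a) = (a * a - K k1) + (c * a + b * c + a * b - K k2)"
    by (simp add: z_def s_def algebra_simps)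
  then show ?thesis using I_add[OF aa rel_abc] unfolding eqv_def by (simp only:)
qed

text \<open>The rule \<open>equiv\<close> makes this the preimage of the span in the quotient. The
  six \<open>m\<close> are the reduced words of the symmetric group on three letters, whose
  relations \<open>a\<close> and \<open>b\<close> satisfy up to scalars and shorter words.\<close>

inductive_set Sp :: "'r set" where
  basis: "k < 3 \<Longrightarrow> i < 2 \<Longrightarrow> j < 2 \<Longrightarrow> m \<in> {1, a, b, a * b, b * a, a * b * a} \<Longrightarrow>
    z ^ k * (s ^ i * (d ^ j * m)) \<in> Sp"
| add: "x \<in> Sp \<Longrightarrow> y \<in> Sp \<Longrightarrow> x + y \<in> Sp"
| const: "x \<in> Sp \<Longrightarrow> K r * x \<in> Sp"
| equiv: "x \<in> Sp \<Longrightarrow> x \<approx> y \<Longrightarrow> y \<in> Sp"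

section \<open>Closure of the span under multiplication\<close>

lemma Sp_eqv: "y \<in> Sp \<Longrightarrow> x \<approx> y \<Longrightarrow> x \<in> Sp"
  using Sp.equiv eqv_sym by blast

lemma Sp_minus: "x \<in> Sp \<Longrightarrow> - x \<in> Sp"
  using const[of x "- 1"] by (simp add: K_minus_one)

lemma Sp_diff: "x \<in> Sp \<Longrightarrow> y \<in> Sp \<Longrightarrow> x - y \<in> Sp"
  using add[of x "- y"] Sp_minus by simp

lemma Sp_basis: "m \<in> {1, a, b, a * b, b * a, a * b * a} \<Longrightarrow> m \<in> Sp"
  using basis[of 0 0 0 m] by simp

lemma Sp_left_z: "x \<in> Sp \<Longrightarrow> z * x \<in> Sp"
proof (induction rule: Sp.induct)
  case (basis k i j m)
  let ?y = "s ^ i * (d ^ j * m)"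
  show ?case
  proof (cases "k < 2")
    case True
    then show ?thesis using Sp.basis[of "Suc k" i j m] basis by (simp add: mult.assoc)
  next
    case False
    then have k: "k = 2" using basis by simp
    \<comment> \<open>The exponent 3 wraps around to 0 by the cube relation.\<close>
    have "K k3 * ?y \<in> Sp" using Sp.const[OF Sp.basis[of 0 i j m]] basis by simp
    moreover have "K k3 * ?y \<approx> z * (z ^ k * ?y)"
      using eqv_right[OF eqv_sym[OF zzz], of ?y] by (simp add: k power2_eq_square mult.assoc)
    ultimately show ?thesis by (rule Sp.equiv)
  qed
qed (auto simp: distrib_left K_left intro: Sp.intros eqv_left)

lemma Sp_left_z_power: "x \<in> Sp \<Longrightarrow> z ^ n * x \<in> Sp"
  by (induction n) (simp_all add: mult.assoc Sp_left_z)

lemma s_z_power: "s * z ^ n \<approx> z ^ n * s"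
proof (induction n)
  case (Suc n)
  have "s * z ^ Suc n = (s * z) * z ^ n" by (simp add: mult.assoc)
  also have "\<dots> \<approx> (z * s) * z ^ n" by (rule eqv_right[OF sz])
  also have "\<dots> = z * (s * z ^ n)" by (simp add: mult.assoc)
  also have "\<dots> \<approx> z * (z ^ n * s)" by (rule eqv_left[OF Suc])
  also have "\<dots> = z ^ Suc n * s" by (simp add: mult.assoc)
  finally show ?case .
qed simp

lemma d_z_power: "d * z ^ n \<approx> z ^ n * d"
proof (induction n)
  case (Suc n)
  have "d * z ^ Suc n = (d * z) * z ^ n" by (simp add: mult.assoc)
  also have "\<dots> \<approx> (z * d) * z ^ n" by (rule eqv_right[OF dz])
  also have "\<dots> = z * (d * z ^ n)" by (simp add: mult.assoc)
  also have "\<dots> \<approx> z * (z ^ n * d)" by (rule eqv_left[OF Suc])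
  also have "\<dots> = z ^ Suc n * d" by (simp add: mult.assoc)
  finally show ?case .
qed simp

text \<open>\<open>s\<close> moves past the powers of \<open>z\<close>, and a second
  \<open>s\<close> is removed by \<open>ss\<close>, which brings in only scalars and
  \<open>z\<close>.\<close>

lemma Sp_left_s: "x \<in> Sp \<Longrightarrow> s * x \<in> Sp"
proof (induction rule: Sp.induct)
  case (basis k i j m)
  let ?y = "d ^ j * m"
  have "z ^ k * (s * (s ^ i * ?y)) \<in> Sp"
  proof (rule Sp_left_z_power, cases "i = 0")
    case True
    then show "s * (s ^ i * ?y) \<in> Sp" using Sp.basis[of 0 1 j m] basis by simp
  next
    case False
    then have i: "i = 1" using basis by simp
    have y: "?y \<in> Sp" using Sp.basis[of 0 0 j m] basis by simp
    have "s * (s ^ i * ?y) \<approx> K k1 * ?y + K k1 * ?y + K k1 * ?y + K k2 * ?y + K k2 * ?y + z * ?y"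
      using eqv_right[OF ss, of ?y] by (simp add: i distrib_right mult.assoc)
    then show "s * (s ^ i * ?y) \<in> Sp"
      by (rule Sp_eqv[rotated]) (intro Sp.add Sp.const Sp_left_z y)
  qed
  moreover have "z ^ k * (s * (s ^ i * ?y)) \<approx> s * (z ^ k * (s ^ i * ?y))"
    using eqv_right[OF eqv_sym[OF s_z_power[of k]], of "s ^ i * ?y"] by (simp add: mult.assoc)
  ultimately show ?case by (rule Sp.equiv)
qed (auto simp: distrib_left K_left intro: Sp.intros eqv_left)

text \<open>\<open>d\<close> moves past \<open>z\<close> and, by \<open>ds\<close>, past
  \<open>s\<close> at the cost of scalars and \<open>z\<close>; a second \<open>d\<close> is removed
  because \<open>d^2\<close> is a scalar.\<close>

lemma Sp_left_d: "x \<in> Sp \<Longrightarrow> d * x \<in> Sp"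
proof (induction rule: Sp.induct)
  case (basis k i j m)
  have d: "d * (d ^ j * m) \<in> Sp"
  proof (cases "j = 0")
    case True
    then show ?thesis using Sp.basis[of 0 0 1 m] basis by simp
  next
    case False
    then have j: "j = 1" using basis by simp
    have "K k1 * m \<in> Sp" by (intro Sp.const Sp_basis basis)
    moreover have "K k1 * m \<approx> d * (d ^ j * m)"
      using I_minus[OF I_right[OF dd, of m]] by (simp add: eqv_def j algebra_simps)
    ultimately show ?thesis by (rule Sp.equiv)
  qed
  have "z ^ k * (d * (s ^ i * (d ^ j * m))) \<in> Sp"
  proof (rule Sp_left_z_power, cases "i = 0")
    case True
    then show "d * (s ^ i * (d ^ j * m)) \<in> Sp" using d by simp
  next
    case False
    then have i: "i = 1" using basis by simp
    let ?y = "d ^ j * m"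
    have y: "?y \<in> Sp" using Sp.basis[of 0 0 j m] basis by simp
    have "d * (s ^ i * ?y) \<approx> K k2 * ?y + K k2 * ?y - z * ?y - s * (d * ?y)"
      using eqv_right[OF ds, of ?y] by (simp add: i distrib_right left_diff_distrib mult.assoc)
    then show "d * (s ^ i * ?y) \<in> Sp"
      by (rule Sp_eqv[rotated]) (intro Sp.add Sp_diff Sp.const Sp_left_z Sp_left_s y d)
  qed
  moreover have "z ^ k * (d * (s ^ i * (d ^ j * m))) \<approx> d * (z ^ k * (s ^ i * (d ^ j * m)))"
    using eqv_right[OF eqv_sym[OF d_z_power[of k]], of "s ^ i * (d ^ j * m)"] by (simp add: mult.assoc)
  ultimately show ?case by (rule Sp.equiv)
qed (auto simp: distrib_left K_left intro: Sp.intros eqv_left)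

lemma Sp_left_power: "x \<in> Sp \<Longrightarrow> s ^ n * x \<in> Sp" "x \<in> Sp \<Longrightarrow> d ^ n * x \<in> Sp"
  by (induction n) (simp_all add: mult.assoc Sp_left_s Sp_left_d)

text \<open>The left factors \<open>z\<close>, \<open>s\<close>, \<open>d\<close> are absorbed by
  the previous lemmas, so right multiplication has to be examined on the six words alone.\<close>

lemma Sp_right:
  assumes "\<And>m. m \<in> {1, a, b, a * b, b * a, a * b * a} \<Longrightarrow> m * q \<in> Sp" and "x \<in> Sp"
  shows "x * q \<in> Sp"
  using assms(2)
proof (induction rule: Sp.induct)
  case (basis k i j m)
  then have "z ^ k * (s ^ i * (d ^ j * (m * q))) \<in> Sp"
    by (intro Sp_left_z_power Sp_left_power assms(1))
  then show ?case by (simp add: mult.assoc)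
next
  case (equiv x y)
  then show ?case using Sp.equiv eqv_right by blast
qed (auto simp: distrib_right mult.assoc intro: Sp.intros)

lemma Sp_one: "1 \<in> Sp" and Sp_K: "K r \<in> Sp" and Sp_a: "a \<in> Sp" and Sp_b: "b \<in> Sp"
  and Sp_s: "s \<in> Sp" and Sp_z: "z \<in> Sp" and Sp_d: "d \<in> Sp"
proof -
  show "1 \<in> Sp" "a \<in> Sp" "b \<in> Sp" by (simp_all add: Sp_basis)
  then show "K r \<in> Sp" "s \<in> Sp" "z \<in> Sp" "d \<in> Sp"
    using Sp.const[of 1 r] Sp_left_s[of 1] Sp_left_z[of 1] Sp_left_d[of 1] by simp_all
qed

lemma K_eqv: "a * (a * r) \<approx> K k1 * r" "b * (b * r) \<approx> K k1 * r" "a * a \<approx> K k1" "b * b \<approx> K k1"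
  using eqv_right[of "a * a" "K k1" r] eqv_right[of "b * b" "K k1" r] aa bb
  by (simp_all add: eqv_def mult.assoc)

lemma Sp_right_a: "x \<in> Sp \<Longrightarrow> x * a \<in> Sp"
proof (rule Sp_right)
  fix m assume m: "m \<in> {1, a, b, a * b, b * a, a * b * a}"
  have 1: "K k1 \<in> Sp" "K k1 * b \<in> Sp" "K k1 * (a * b) \<in> Sp"
    by (intro Sp_K Sp.const Sp_basis; simp)+
  have "b * (a * a) \<approx> K k1 * b" "a * (b * (a * a)) \<approx> K k1 * (a * b)"
    using eqv_left[OF K_eqv(3), of b] eqv_left[OF K_eqv(3), of "a * b"]
    by (simp_all add: K_central mult.assoc)
  then have "a * a \<in> Sp" "b * (a * a) \<in> Sp" "a * (b * (a * a)) \<in> Sp"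
    using 1 Sp.equiv eqv_sym K_eqv by blast+
  then show "m * a \<in> Sp" using m Sp_basis[of "m * a"] by (auto simp: mult.assoc)
qed

text \<open>The braid relation rewrites \<open>bab\<close>, and after multiplication by
  \<open>a\<close> also \<open>abab\<close>; the other products end in \<open>bb\<close> or are
  among the six words.\<close>

lemma Sp_right_b: "x \<in> Sp \<Longrightarrow> x * b \<in> Sp"
proof (rule Sp_right)
  fix m assume m: "m \<in> {1, a, b, a * b, b * a, a * b * a}"
  have ab: "a * b \<in> Sp" "b * a \<in> Sp" "a * (b * a) \<in> Sp"
    using Sp_basis by (simp_all add: mult.assoc)
  have "b * b \<in> Sp" using Sp_K K_eqv(4) Sp.equiv eqv_sym by blast
  moreover have "a * (b * b) \<in> Sp"
  proof (rule Sp.equiv)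
    show "K k1 * a \<in> Sp" by (intro Sp.const Sp_a)
    show "K k1 * a \<approx> a * (b * b)"
      using eqv_left[OF eqv_sym[OF K_eqv(4)], of a] by (simp add: K_central)
  qed
  moreover have "b * (a * b) \<in> Sp"
  proof (rule Sp.equiv)
    show "a * (b * a) + K k2 * b - K k2 * a \<in> Sp"
      by (intro Sp_diff Sp.add Sp.const ab Sp_a Sp_b)
  qed (rule eqv_sym[OF braid_ab])
  moreover have "a * (b * (a * b)) \<in> Sp"
  proof (rule Sp.equiv)
    show "K k1 * (b * a) + K k2 * (a * b) - K k2 * K k1 \<in> Sp"
      by (intro Sp_diff Sp.add Sp.const ab Sp_K)
    have "a * (b * (a * b)) \<approx> a * (a * (b * a) + K k2 * b - K k2 * a)"
      by (rule eqv_left[OF braid_ab])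
    also have "\<dots> = a * (a * (b * a)) + K k2 * (a * b) - K k2 * (a * a)"
      by (simp add: distrib_left right_diff_distrib K_left)
    also have "\<dots> \<approx> K k1 * (b * a) + K k2 * (a * b) - K k2 * K k1"
      by (intro eqv_diff eqv_add K_eqv eqv_left eqv_refl)
    finally show "K k1 * (b * a) + K k2 * (a * b) - K k2 * K k1 \<approx> a * (b * (a * b))"
      by (rule eqv_sym)
  qed
  ultimately show "m * b \<in> Sp" using m ab Sp_b by (auto simp: mult.assoc)
qed

text \<open>A final \<open>c\<close> is removed by \<open>ac\<close> and \<open>bc\<close>. The
  words are treated in an order in which each one produces only terms covered by earlier
  ones.\<close>

lemma Sp_right_c: "x \<in> Sp \<Longrightarrow> x * c \<in> Sp"
proof (rule Sp_right)
  fix m assume m: "m \<in> {1, a, b, a * b, b * a, a * b * a}"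
  note cl = Sp_diff Sp.add Sp.const Sp_a Sp_b Sp_K Sp_z Sp_left_s Sp_left_z Sp_right_a Sp_right_b Sp_s
  have c: "c \<in> Sp" using Sp_diff[OF Sp_diff[OF Sp_s Sp_a] Sp_b] by (simp add: s_def)
  have ab: "a * b \<in> Sp" "b * a \<in> Sp" by (intro cl)+
  have acS: "a * c \<in> Sp" by (rule Sp_eqv[OF _ ac]) (intro cl ab)
  have bcS: "b * c \<in> Sp" by (rule Sp_eqv[OF _ bc]) (intro cl ab)
  have aS: "a * s \<in> Sp" and bS: "b * s \<in> Sp"
    unfolding s_def distrib_left by (intro cl ab acS bcS)+
  have abc: "a * (b * c) \<in> Sp"
  proof (rule Sp_eqv[OF _ eqv_left[OF bc]])
    have "a * (K k1 + K k2 - a * b - s * a + b * a) =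
       K k1 * a + K k2 * a - (a * a) * b - (a * s) * a + a * b * a"
      by (simp add: distrib_left right_diff_distrib K_central mult.assoc)
    also have "\<dots> \<in> Sp" by (intro cl aS)
    finally show "a * (K k1 + K k2 - a * b - s * a + b * a) \<in> Sp" .
  qed
  have bzS: "b * z \<in> Sp" by (rule Sp_eqv[OF _ bz]) (intro cl c)
  have bac: "b * (a * c) \<in> Sp"
  proof (rule Sp_eqv[OF _ eqv_left[OF ac]])
    have "b * (K k1 + K k2 + z - s * b + a * b - b * a) =
       K k1 * b + K k2 * b + b * z - (b * s) * b + b * a * b - b * b * a"
      by (simp add: distrib_left right_diff_distrib K_central mult.assoc)
    also have "\<dots> \<in> Sp" by (intro cl bS bzS)
    finally show "b * (K k1 + K k2 + z - s * b + a * b - b * a) \<in> Sp" .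
  qed
  have abac: "a * (b * (a * c)) \<in> Sp"
  proof (rule Sp_eqv[OF _ eqv_left[OF eqv_left[OF ac]]])
    have "a * (b * z) \<approx> a * (z * c)" by (rule eqv_left[OF bz])
    also have "\<dots> = (a * z) * c" by (simp add: mult.assoc)
    also have "\<dots> \<approx> (z * b) * c" by (rule eqv_right[OF az])
    also have "\<dots> = z * (b * c)" by (simp add: mult.assoc)
    finally have abz: "a * (b * z) \<in> Sp" by (rule Sp_eqv[rotated]) (intro cl bcS)
    \<comment> \<open>Here \<open>s\<close> is expanded, so that \<open>abs\<close> becomes
      \<open>aba + abb + abc\<close>, whose last word has just been treated.\<close>
    have "a * (b * (K k1 + K k2 + z - s * b + a * b - b * a)) =
       K k1 * (a * b) + K k2 * (a * b) + a * (b * z) - (a * b * a + a * b * b + a * (b * c)) * b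
         + a * b * a * b - a * b * b * a"
      by (simp add: s_def distrib_left distrib_right right_diff_distrib K_central K_left mult.assoc)
    also have "\<dots> \<in> Sp" by (intro cl abz abc)
    finally show "a * (b * (K k1 + K k2 + z - s * b + a * b - b * a)) \<in> Sp" .
  qed
  show "m * c \<in> Sp" using m c acS bcS abc bac abac by (auto simp: mult.assoc)
qed

text \<open>\<open>d\<close> moves to the left through \<open>ad = k2 - db - ba\<close> and
  \<open>bd = k2 - dc - cb\<close>; right multiplication by \<open>a\<close>, \<open>b\<close>,
  \<open>c\<close> is known by now.\<close>

lemma Sp_right_d: "x \<in> Sp \<Longrightarrow> x * d \<in> Sp"
proof (rule Sp_right)
  fix m assume m: "m \<in> {1, a, b, a * b, b * a, a * b * a}"
  note cl = Sp_diff Sp.add Sp.const Sp_a Sp_b Sp_K Sp_d Sp_left_d Sp_right_a Sp_right_b Sp_right_c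
  have c: "c \<in> Sp" using Sp_diff[OF Sp_diff[OF Sp_s Sp_a] Sp_b] by (simp add: s_def)
  have adE: "a * d \<approx> K k2 - d * b - b * a"
    using rel_abd by (simp add: eqv_def algebra_simps)
  have bdE: "b * d \<approx> K k2 - d * c - c * b"
    using rel_bcd by (simp add: eqv_def algebra_simps)
  have ad: "a * d \<in> Sp" by (rule Sp_eqv[OF _ adE]) (intro cl)
  have bd: "b * d \<in> Sp" by (rule Sp_eqv[OF _ bdE]) (intro cl c)
  have abd: "a * (b * d) \<in> Sp"
  proof (rule Sp_eqv[OF _ eqv_left[OF bdE]])
    have "a * (K k2 - d * c - c * b) = K k2 * a - (a * d) * c - a * c * b"
      by (simp add: right_diff_distrib K_central mult.assoc)
    also have "\<dots> \<in> Sp" by (intro cl ad)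
    finally show "a * (K k2 - d * c - c * b) \<in> Sp" .
  qed
  have bad: "b * (a * d) \<in> Sp"
  proof (rule Sp_eqv[OF _ eqv_left[OF adE]])
    have "b * (K k2 - d * b - b * a) = K k2 * b - (b * d) * b - b * b * a"
      by (simp add: right_diff_distrib K_central mult.assoc)
    also have "\<dots> \<in> Sp" by (intro cl bd)
    finally show "b * (K k2 - d * b - b * a) \<in> Sp" .
  qed
  have abad: "a * (b * (a * d)) \<in> Sp"
  proof (rule Sp_eqv[OF _ eqv_left[OF eqv_left[OF adE]]])
    have "a * (b * (K k2 - d * b - b * a)) = K k2 * (a * b) - (a * (b * d)) * b - a * b * b * a"
      by (simp add: right_diff_distrib K_central K_left mult.assoc)
    also have "\<dots> \<in> Sp" by (intro cl abd)
    finally show "a * (b * (K k2 - d * b - b * a)) \<in> Sp" .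
  qed
  show "m * d \<in> Sp" using m ad bd abd bad abad Sp_d by (auto simp: mult.assoc)
qed

section \<open>Coordinates along the 72 words\<close>

definition "mons = [1, a, b, a * b, b * a, a * b * a]"
lemma length_mons: "length mons = 6" by (simp add: mons_def)
definition "word_index = {..<3::nat} \<times> {..<2::nat} \<times> {..<2::nat} \<times> {..<6::nat}"
definition "word_basis = (\<lambda>(k, i, j, t). z ^ k * (s ^ i * (d ^ j * mons ! t)))"

lemma finite_word_index: "finite word_index" and card_word_index: "card word_index = 72"
  by (simp_all add: word_index_def card_cartesian_product)

lemma Sp_combination: "x \<in> Sp \<Longrightarrow> \<exists>v. x \<approx> (\<Sum>q\<in>word_index. K (v q) * word_basis q)"
proof (induction rule: Sp.induct)
  case (basis k i j m)
  then have "m \<in> set mons" by (auto simp: mons_def)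
  then obtain t where t: "t < 6" "m = mons ! t"
    by (metis in_set_conv_nth length_mons)
  let ?q = "(k, i, j, t)"
  have q: "?q \<in> word_index" using basis t by (simp add: word_index_def)
  have "(\<Sum>p\<in>word_index. K (if p = ?q then 1 else 0) * word_basis p) = (\<Sum>p\<in>word_index. if p = ?q then word_basis p else 0)"
    by (rule sum.cong) (auto simp: K_one K_zero)
  also have "\<dots> = word_basis ?q" using q finite_word_index by simp
  finally show ?case using t by (intro exI[of _ "\<lambda>p. if p = ?q then 1 else 0"]) (simp add: word_basis_def)
next
  case (add x y)
  then obtain v w where "x \<approx> (\<Sum>q\<in>word_index. K (v q) * word_basis q)" "y \<approx> (\<Sum>q\<in>word_index. K (w q) * word_basis q)" by blast
  from eqv_add[OF this] show ?case
    by (intro exI[of _ "\<lambda>q. v q + w q"]) (simp add: K_add distrib_right sum.distrib)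
next
  case (const x r)
  then obtain v where "x \<approx> (\<Sum>q\<in>word_index. K (v q) * word_basis q)" by blast
  from eqv_left[OF this, of "K r"] show ?case
    by (intro exI[of _ "\<lambda>q. r * v q"]) (simp add: K_mult sum_distrib_left mult.assoc)
next
  case (equiv x y)
  then show ?case using eqv_trans eqv_sym by blast
qed

text \<open>The 72 spanning words map onto a spanning set of a 72-dimensional space, hence to a basis.\<close>

lemma kernel_subset_I:
  fixes h :: "'r \<Rightarrow> ('k, 'n::finite) Finite_Cartesian_Product.vec"
  assumes h_add: "\<And>x y. h (x + y) = h x + h y" and h_K: "\<And>r x. h (K r * x) = r *s h x"
    and h_I: "\<And>x. x \<in> I \<Longrightarrow> h x = 0" and Sp: "Sp = UNIV" and surj: "surj h"
    and card: "CARD('n) = 72" and x: "h x = 0"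
  shows "x \<in> I"
proof -
  define f where "f = h \<circ> word_basis"
  have h0: "h 0 = 0" using h_I[OF I_zero] .
  have h_eqv: "h u = h w" if "u \<approx> w" for u w
    using h_add[of "u - w" w] h_I[of "u - w"] that by (simp add: eqv_def)
  have h_sum: "h (sum g A) = (\<Sum>q\<in>A. h (g q))" for g and A :: "(nat \<times> nat \<times> nat \<times> nat) set"
    by (induction A rule: infinite_finite_induct) (simp_all add: h0 h_add)
  have comb: "\<exists>v. u \<approx> (\<Sum>q\<in>word_index. K (v q) * word_basis q) \<and> h u = (\<Sum>q\<in>word_index. v q *s f q)" for u
  proof -
    obtain v where v: "u \<approx> (\<Sum>q\<in>word_index. K (v q) * word_basis q)" using Sp Sp_combination by blast
    then show ?thesis using h_eqv[OF v] by (intro exI[of _ v]) (simp add: h_sum h_K f_def)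
  qed
  have span: "vec.span (f ` word_index) = UNIV"
  proof -
    have "y \<in> vec.span (f ` word_index)" for y
    proof -
      obtain u where "y = h u" using surj by blast
      then obtain v where "y = (\<Sum>q\<in>word_index. v q *s f q)" using comb by blast
      then show ?thesis by (simp only:) (intro vec.span_sum vec.span_scale vec.span_base imageI)
    qed
    then show ?thesis by blast
  qed
  have dim: "vec.dim (UNIV :: ('k, 'n) Finite_Cartesian_Product.vec set) = 72"
    using card by (simp add: vec.dim_UNIV vec.dimension_def card_cart_basis)
  have "72 \<le> card (f ` word_index)"
    using vec.dim_le_card[of UNIV "f ` word_index"] span dim finite_word_index by simp
  moreover have le: "card (f ` word_index) \<le> card word_index" by (rule card_image_le[OF finite_word_index])
  ultimately have eq: "card (f ` word_index) = card word_index" using card_word_index by simp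
  then have inj: "inj_on f word_index" by (rule eq_card_imp_inj_on[OF finite_word_index])
  have indep: "vec.independent (f ` word_index)"
    by (rule vec.card_le_dim_spanning[of _ UNIV]) (use span dim finite_word_index eq card_word_index in auto)
  obtain v where v: "x \<approx> (\<Sum>q\<in>word_index. K (v q) * word_basis q)" "h x = (\<Sum>q\<in>word_index. v q *s f q)"
    using comb by blast
  \<comment> \<open>As \<open>f\<close> is injective, the coefficients can be indexed by its image,
    where linear independence applies.\<close>
  have "(\<Sum>y\<in>f ` word_index. v (the_inv_into word_index f y) *s y) = 0"
    using v x inj by (simp add: sum.reindex the_inv_into_f_f)
  then have "v (the_inv_into word_index f y) = 0" if "y \<in> f ` word_index" for y
    using vec.independentD[OF indep _ subset_refl, of "\<lambda>y. v (the_inv_into word_index f y)" y] finite_word_index that by simp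
  then have "v q = 0" if "q \<in> word_index" for q using that inj by (metis imageI the_inv_into_f_f)
  then have "(\<Sum>q\<in>word_index. K (v q) * word_basis q) = 0" by (simp add: K_zero)
  then show ?thesis using v(1) by (simp add: eqv_def)
qed

end

section \<open>Semisimplicity and the quotient algebra\<close>

text \<open>
  For \<open>y\<close> in a simple left ideal \<open>L\<close>, either \<open>R x y = 0\<close> or \<open>R x y = L\<close>; in the second case \<open>y = r x y\<close>
  and so \<open>h (x y) = h (x r x) h y = 0\<close>. As such \<open>y\<close> generate \<open>R\<close>, \<open>h x = h (x 1) = 0\<close>.
\<close>

lemma semisimple_annihilator:
  fixes R (structure) and h :: "'a \<Rightarrow> 'r::ring_1"
  assumes "ring R" and "semisimple R"
    and h_add: "\<And>u v. u \<in> carrier R \<Longrightarrow> v \<in> carrier R \<Longrightarrow> h (u \<oplus> v) = h u + h v"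
    and h_mult: "\<And>u v. u \<in> carrier R \<Longrightarrow> v \<in> carrier R \<Longrightarrow> h (u \<otimes> v) = h u * h v"
    and h_one: "h \<one> = 1"
    and x: "x \<in> carrier R" and null: "\<And>r. r \<in> carrier R \<Longrightarrow> h x * h r * h x = 0"
  shows "h x = 0"
proof -
  interpret ring R by fact
  have h_zero: "h \<zero> = 0" using h_add[of \<zero> \<zero>] by simp
  have simple: "h x * h y = 0" and carr: "y \<in> carrier R"
    if L: "simple_left_ideal L R" and y: "y \<in> L" for L y
  proof -
    interpret L: additive_subgroup L R using L by (simp add: simple_left_ideal_def left_ideal_def)
    have absorb: "\<And>r u. r \<in> carrier R \<Longrightarrow> u \<in> L \<Longrightarrow> r \<otimes> u \<in> L"
      using L by (simp add: simple_left_ideal_def left_ideal_def)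
    show yR: "y \<in> carrier R" using y L.a_subset by blast
    define L' where "L' = {r \<otimes> (x \<otimes> y) | r. r \<in> carrier R}"
    have xy: "x \<otimes> y \<in> carrier R" using x yR by simp
    have "left_ideal L' R"
      unfolding left_ideal_def
    proof (intro conjI ballI)
      show "additive_subgroup L' R"
      proof (rule additive_subgroup.intro, rule a_group[THEN group.subgroupI])
        show "L' \<subseteq> carrier (add_monoid R)" using xy by (auto simp: L'_def)
        show "L' \<noteq> {}" by (auto simp: L'_def)
        fix u assume "u \<in> L'"
        then obtain r where r: "r \<in> carrier R" "u = r \<otimes> (x \<otimes> y)" by (auto simp: L'_def)
        have "inv\<^bsub>add_monoid R\<^esub> u = (\<ominus> r) \<otimes> (x \<otimes> y)"
          using r xy by (simp add: a_inv_def[symmetric] l_minus)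
        then show "inv\<^bsub>add_monoid R\<^esub> u \<in> L'" using r by (auto simp: L'_def)
        fix v assume "v \<in> L'"
        then obtain r' where r': "r' \<in> carrier R" "v = r' \<otimes> (x \<otimes> y)" by (auto simp: L'_def)
        have "u \<oplus> v = (r \<oplus> r') \<otimes> (x \<otimes> y)" using r r' xy by (simp add: l_distr)
        then show "u \<otimes>\<^bsub>add_monoid R\<^esub> v \<in> L'" using r r' by (auto simp: L'_def)
      qed
      fix q u assume q: "q \<in> carrier R" and "u \<in> L'"
      then obtain r where r: "r \<in> carrier R" "u = r \<otimes> (x \<otimes> y)" by (auto simp: L'_def)
      have "q \<otimes> u = (q \<otimes> r) \<otimes> (x \<otimes> y)" using q r xy by (simp add: m_assoc)
      then show "q \<otimes> u \<in> L'" using q r by (auto simp: L'_def)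
    qed
    moreover have "L' \<subseteq> L" using absorb x y by (auto simp: L'_def)
    ultimately consider "L' = {\<zero>}" | "L' = L" using L by (auto simp: simple_left_ideal_def)
    then have "h (x \<otimes> y) = 0"
    proof cases
      case 1
      have "\<one> \<otimes> (x \<otimes> y) \<in> L'" by (auto simp: L'_def)
      then show ?thesis using 1 xy h_zero by simp
    next
      case 2
      then obtain r where r: "r \<in> carrier R" "y = r \<otimes> (x \<otimes> y)" using y by (auto simp: L'_def)
      have "h (x \<otimes> y) = h x * h (r \<otimes> (x \<otimes> y))" using r x yR h_mult by metis
      also have "\<dots> = (h x * h r * h x) * h y" using r(1) x yR by (simp add: h_mult mult.assoc)
      finally show ?thesis using null[OF r(1)] by simp
    qed
    then show "h x * h y = 0" using x yR by (simp add: h_mult)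
  qed
  have "h x * h y = 0 \<and> y \<in> carrier R" if "y \<in> generate (add_monoid R) (\<Union>{L. simple_left_ideal L R})" for y
    using that
  proof (induction rule: generate.induct)
    case one
    then show ?case by (simp add: h_zero)
  next
    case (incl u)
    then show ?case using simple carr by blast
  next
    case (inv u)
    then have u: "h x * h u = 0" "u \<in> carrier R" using simple carr by blast+
    have "h u + h (\<ominus> u) = 0" using u(2) h_add[of u "\<ominus> u"] by (simp add: r_neg h_zero)
    then have "h (\<ominus> u) = - h u" by (simp add: eq_neg_iff_add_eq_0 add.commute)
    then show ?case using u by (simp add: a_inv_def[symmetric])
  next
    case (eng u v)
    then show ?case by (simp add: h_add distrib_left)
  qed
  then have "h x * h \<one> = 0" using \<open>semisimple R\<close> unfolding semisimple_def by simp
  then show ?thesis by (simp add: h_one)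
qed

section \<open>The quotient algebra and its representations\<close>

lemma ring_extend_simps [simp]:
  "carrier (ring.extend R f) = carrier R" "mult (ring.extend R f) = mult R"
  "one (ring.extend R f) = one R" "zero (ring.extend R f) = zero R" "add (ring.extend R f) = add R"
  by (simp_all add: ring.defs)

lemma ring_ring_extend:
  assumes "ring R"
  shows "ring (ring.extend R f)"
proof -
  interpret ring R by fact
  show ?thesis
  proof (rule ringI)
    show "abelian_group (ring.extend R f)"
      by (rule abelian_groupI) (auto simp: a_assoc intro: a_comm intro!: bexI[of _ "a_inv R x" for x] l_neg)
    show "Group.monoid (ring.extend R f)"
      by (rule monoidI) (auto simp: m_assoc)
  qed (auto simp: l_distr r_distr)
qed

definition T_ideal :: "'k::field \<Rightarrow> 'k \<Rightarrow> 'k \<Rightarrow> (tetra_gen, 'k) free_alg set" where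
  "T_ideal \<alpha>1 \<alpha>2 \<alpha>3 = Idl\<^bsub>free_algebra\<^esub> (T_relations \<alpha>1 \<alpha>2 \<alpha>3)"

lemma ideal_T_ideal: "ideal (T_ideal \<alpha>1 \<alpha>2 \<alpha>3) free_algebra"
  unfolding T_ideal_def by (rule free_algebra.genideal_ideal) simp

lemma ring_T_algebra: "ring (T_algebra \<alpha>1 \<alpha>2 \<alpha>3)"
  unfolding T_algebra_def quotient_algebra_def
  by (rule ring_ring_extend) (rule ideal.quotient_is_ring[OF ideal_T_ideal[unfolded T_ideal_def]])

lemma tetra_relations_T_ideal:
  "tetra_relations (T_ideal \<alpha>1 \<alpha>2 \<alpha>3) free_const \<alpha>1 \<alpha>2 \<alpha>3
    (free_gen gen_a) (free_gen gen_b) (free_gen gen_c) (free_gen gen_d)"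
proof -
  have "T_relations \<alpha>1 \<alpha>2 \<alpha>3 \<subseteq> T_ideal \<alpha>1 \<alpha>2 \<alpha>3"
    unfolding T_ideal_def by (rule free_algebra.genideal_self) simp
  then have rels: "r \<in> T_ideal \<alpha>1 \<alpha>2 \<alpha>3" if "r \<in> T_relations \<alpha>1 \<alpha>2 \<alpha>3" for r
    using that by blast
  note D = ideal_free_algebraD[OF ideal_T_ideal]
  show ?thesis
    by unfold_locales
      (rule D(1) free_const_hom free_const_central | (rule D(2); assumption) | (rule D(3); assumption)
        | (rule D(4); assumption) | (rule rels, simp add: T_relations_def Let_def power2_eq_square))+
qed

text \<open>The span contains the constants and is stable under right multiplication by each
  generator.\<close>

lemma T_span_UNIV:
  "tetra_relations.Sp (T_ideal \<alpha>1 \<alpha>2 \<alpha>3) free_const \<alpha>2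
    (free_gen gen_a) (free_gen gen_b) (free_gen gen_c) (free_gen gen_d) = UNIV"
proof -
  interpret tetra_relations "T_ideal \<alpha>1 \<alpha>2 \<alpha>3" free_const \<alpha>1 \<alpha>2 \<alpha>3
    "free_gen gen_a" "free_gen gen_b" "free_gen gen_c" "free_gen gen_d"
    by (rule tetra_relations_T_ideal)
  have "f \<in> Sp" for f
  proof (induction f rule: free_alg_gen_induct)
    case (gen f x)
    then show ?case by (cases x) (auto intro: Sp_right_a Sp_right_b Sp_right_c Sp_right_d)
  qed (auto intro: Sp_K Sp.add)
  then show ?thesis by blast
qed

text \<open>A representation of the algebra in \<open>'r\<close>: evaluation at such a
  \<open>g\<close> kills the relators and hence the ideal.\<close>

locale T_evaluation = evaluation e g for e :: "'k::field \<Rightarrow> 'r::ring_1" and g :: "tetra_gen \<Rightarrow> 'r" +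
  fixes \<alpha>1 \<alpha>2 \<alpha>3 :: 'k
  assumes sq: "g x * g x = e \<alpha>1"
    and r_abc: "g gen_c * g gen_a + g gen_b * g gen_c + g gen_a * g gen_b = e \<alpha>2"
    and r_acd: "g gen_d * g gen_a + g gen_c * g gen_d + g gen_a * g gen_c = e \<alpha>2"
    and r_abd: "g gen_d * g gen_b + g gen_b * g gen_a + g gen_a * g gen_d = e \<alpha>2"
    and r_bcd: "g gen_d * g gen_c + g gen_c * g gen_b + g gen_b * g gen_d = e \<alpha>2"
    and r_cube: "(g gen_c * g gen_b + g gen_b * g gen_a + g gen_a * g gen_c - e \<alpha>2) ^ 3 = e \<alpha>3"
begin

lemma T_ideal_kernel: "f \<in> T_ideal \<alpha>1 \<alpha>2 \<alpha>3 \<Longrightarrow> ev f = 0"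
proof -
  have "T_ideal \<alpha>1 \<alpha>2 \<alpha>3 \<subseteq> {f. ev f = 0}"
    unfolding T_ideal_def
    by (rule free_algebra.genideal_minimal[OF ideal_kernel])
       (simp add: T_relations_def Let_def ev_simps power2_eq_square sq r_abc r_acd r_abd r_bcd r_cube)
  then show "f \<in> T_ideal \<alpha>1 \<alpha>2 \<alpha>3 \<Longrightarrow> ev f = 0" by blast
qed

lemma not_semisimple_T:
  assumes "ev f \<noteq> 0" and "\<And>r. ev f * ev r * ev f = 0"
  shows "\<not> semisimple (T_algebra \<alpha>1 \<alpha>2 \<alpha>3)"
proof
  assume ss: "semisimple (T_algebra \<alpha>1 \<alpha>2 \<alpha>3)"
  let ?A = "free_algebra :: ('k, (tetra_gen, 'k) free_alg) module"
  let ?T = "T_algebra \<alpha>1 \<alpha>2 \<alpha>3" and ?I = "T_ideal \<alpha>1 \<alpha>2 \<alpha>3"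
  let ?p = "\<lambda>x. ?I +>\<^bsub>?A\<^esub> x"
  \<comment> \<open>Any representative serves, since \<open>ev\<close> vanishes on the ideal;
    \<open>H\<close> is the map induced on cosets.\<close>
  define H where "H X = ev (SOME x. x \<in> X)" for X
  interpret I: ideal ?I ?A by (rule ideal_T_ideal)
  have H: "H (?p x) = ev x" for x
  proof -
    have "x \<in> ?p x" using I.a_rcos_self[of x] by simp
    then have "(SOME y. y \<in> ?p x) \<in> ?p x" by (rule someI)
    then obtain i where "i \<in> ?I" "(SOME y. y \<in> ?p x) = i + x" by (auto simp: a_r_coset_def')
    then show ?thesis by (simp add: H_def ev_add T_ideal_kernel)
  qed
  have hom: "?p \<in> Ring.ring_hom ?A (?A Quot ?I)" by (rule I.rcos_ring_hom)
  have T: "carrier ?T = range ?p" "\<And>x y. ?p x \<otimes>\<^bsub>?T\<^esub> ?p y = ?p (x * y)"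
    "\<And>x y. ?p x \<oplus>\<^bsub>?T\<^esub> ?p y = ?p (x + y)" "\<one>\<^bsub>?T\<^esub> = ?p 1"
    using ring_hom_mult[OF hom] ring_hom_add[OF hom] ring_hom_one[OF hom]
    by (auto simp: T_algebra_def quotient_algebra_def T_ideal_def[symmetric] FactRing_def A_RCOSETS_def')
  have "H (?p f) = 0"
  proof (rule semisimple_annihilator[OF ring_T_algebra ss])
    show "?p f \<in> carrier ?T" by (simp add: T)
    fix u v assume "u \<in> carrier ?T" "v \<in> carrier ?T"
    then obtain x y where "u = ?p x" "v = ?p y" by (auto simp: T)
    then show "H (u \<oplus>\<^bsub>?T\<^esub> v) = H u + H v" "H (u \<otimes>\<^bsub>?T\<^esub> v) = H u * H v"
      by (simp_all add: T H ev_simps)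
  next
    show "H \<one>\<^bsub>?T\<^esub> = 1" by (simp add: T H ev_one)
    fix r assume "r \<in> carrier ?T"
    then show "H (?p f) * H r * H (?p f) = 0" using assms(2) by (auto simp: T H)
  qed
  then show False using assms(1) H by simp
qed

end

text \<open>Ties the parameters of the matrices to those of the algebra:
  \<open>p = \<alpha>1 + \<alpha>2\<close>, \<open>q = 3 * \<alpha>1 - \<alpha>2\<close> and
  \<open>l^3 = \<alpha>3\<close>, while \<open>six\<close> permits the division by 6 of the
  matrices.\<close>

locale tetra_rep_alg =
  fixes emb :: "'k::field \<Rightarrow> 'r::comm_ring_1" and \<alpha>1 \<alpha>2 \<alpha>3 \<omega> :: 'k and x y t v l :: 'r
  assumes emb_add: "emb (a + b) = emb a + emb b" and emb_mult: "emb (a * b) = emb a * emb b"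
    and emb_one: "emb 1 = 1"
    and six: "(6::'k) \<noteq> 0" and omega: "\<omega> * \<omega> = - 1 - \<omega>"
    and x_sq: "x * x = y * emb (3 * \<alpha>1 - \<alpha>2) + l"
    and t_sq: "t * t = emb (\<alpha>1 + \<alpha>2) - l * v"
    and ly_eq: "l * y = emb (3 * \<alpha>1 - \<alpha>2) * v - 2 * x * t"
    and l_cube: "l * (l * l) = emb \<alpha>3"
begin

lemma emb_zero: "emb 0 = 0" using emb_add[of 0 0] by simp
lemma emb_minus: "emb (- a) = - emb a"
  using emb_add[of a "- a"] by (simp add: emb_zero eq_neg_iff_add_eq_0 add.commute)
lemma emb_diff: "emb (a - b) = emb a - emb b"
  using emb_add[of a "- b"] emb_minus by simp
lemma emb_of_nat: "emb (of_nat n) = of_nat n"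
  by (induction n) (simp_all add: emb_zero emb_one emb_add)
lemma emb_numeral: "emb (numeral n) = numeral n"
  using emb_of_nat[of "numeral n"] by simp

abbreviation "q \<equiv> emb (3 * \<alpha>1 - \<alpha>2)"
abbreviation "p \<equiv> emb (\<alpha>1 + \<alpha>2)"
abbreviation "w \<equiv> emb \<omega>"

sublocale tetra_rep w x y t v l q p
  using x_sq t_sq ly_eq by unfold_locales (simp_all flip: emb_mult add: omega emb_diff emb_minus emb_one)

definition "e r = scal (emb r)"
definition "gens = (\<lambda>u. e (1 / 6) * (case u of gen_a \<Rightarrow> A | gen_b \<Rightarrow> B | gen_c \<Rightarrow> C | gen_d \<Rightarrow> D))"

lemma e_hom: "e (a + b) = e a + e b" "e (a * b) = e a * e b" "e 1 = 1"
  by (simp_all add: e_def emb_add emb_mult emb_one scal_hom)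

lemma e_comm: "M * e r = e r * M"
  by (simp add: e_def scal_central)

text \<open>\<open>p + q = 4 \<alpha>1\<close> and \<open>3 p - q = 4 \<alpha>2\<close>, so the
  right-hand sides of the matrix relations are 36 times the wanted scalars.\<close>

lemma e_alpha: "e (1 / 6) * (e (1 / 6) * scal (9 * (p + q))) = e \<alpha>1"
  "e (1 / 6) * (e (1 / 6) * scal (9 * (3 * p - q))) = e \<alpha>2"
  "e (1 / 6) * (e (1 / 6) * scal 36) = 1"
proof -
  have s: "scal (9 * (p + q)) = e (36 * \<alpha>1)" "scal (9 * (3 * p - q)) = e (36 * \<alpha>2)" "scal 36 = e 36"
    by (simp_all add: e_def emb_add emb_diff emb_mult emb_numeral algebra_simps)
  have k: "1 / 6 * (1 / 6 * (36 * r)) = (r::'k)" for r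
  proof -
    have "(36::'k) = 6 * 6" by simp
    then have "(36::'k) \<noteq> 0" using six by (metis mult_eq_0_iff)
    then show ?thesis by simp
  qed
  have k1: "1 / 6 * (1 / 6 * 36) = (1::'k)" using k[of 1] by simp
  show "e (1 / 6) * (e (1 / 6) * scal (9 * (p + q))) = e \<alpha>1"
    "e (1 / 6) * (e (1 / 6) * scal (9 * (3 * p - q))) = e \<alpha>2"
    unfolding s e_hom[symmetric] k by rule+
  show "e (1 / 6) * (e (1 / 6) * scal 36) = 1"
    unfolding s e_hom(2)[symmetric] k1 e_hom(3) ..
qed

lemma gens_mult: "e r * M * (e r * N) = e r * (e r * (M * N))"
proof -
  have "e r * M * (e r * N) = e r * ((M * e r) * N)" by (simp only: mult.assoc)
  then show ?thesis by (simp only: e_comm mult.assoc)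
qed

lemma gens_Z: "gens gen_c * gens gen_b + gens gen_b * gens gen_a + gens gen_a * gens gen_c - e \<alpha>2 = Z"
proof -
  have "gens gen_c * gens gen_b + gens gen_b * gens gen_a + gens gen_a * gens gen_c
    = e (1 / 6) * (e (1 / 6) * (C * B + B * A + A * C))"
    unfolding gens_def tetra_gen.case gens_mult distrib_left ..
  also have "\<dots> = e \<alpha>2 + Z"
  proof -
    have "e (1 / 6) * (e (1 / 6) * (scal 36 * Z)) = e (1 / 6) * (e (1 / 6) * scal 36) * Z"
      by (simp only: mult.assoc)
    then show ?thesis by (simp only: rel_Z distrib_left e_alpha mult_1_left)
  qed
  finally show ?thesis by simp
qed

sublocale T_evaluation e gens \<alpha>1 \<alpha>2 \<alpha>3
proof unfold_locales
  fix u show "gens u * gens u = e \<alpha>1"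
    by (cases u) (simp_all only: gens_def tetra_gen.case gens_mult A_squared B_squared C_squared D_squared e_alpha)
next
  show "gens gen_c * gens gen_a + gens gen_b * gens gen_c + gens gen_a * gens gen_b = e \<alpha>2"
    unfolding gens_def tetra_gen.case gens_mult distrib_left[symmetric] rel_ABC e_alpha ..
  show "gens gen_d * gens gen_a + gens gen_c * gens gen_d + gens gen_a * gens gen_c = e \<alpha>2"
    unfolding gens_def tetra_gen.case gens_mult distrib_left[symmetric] rel_ACD e_alpha ..
  show "gens gen_d * gens gen_b + gens gen_b * gens gen_a + gens gen_a * gens gen_d = e \<alpha>2"
    unfolding gens_def tetra_gen.case gens_mult distrib_left[symmetric] rel_ABD e_alpha ..
  show "gens gen_d * gens gen_c + gens gen_c * gens gen_b + gens gen_b * gens gen_d = e \<alpha>2"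
    unfolding gens_def tetra_gen.case gens_mult distrib_left[symmetric] rel_BCD e_alpha ..
  show "(gens gen_c * gens gen_b + gens gen_b * gens gen_a + gens gen_a * gens gen_c - e \<alpha>2) ^ 3 = e \<alpha>3"
    unfolding gens_Z by (simp add: power3_eq_cube mult.assoc Z_cubed e_def l_cube)
qed (rule e_hom e_comm)+

abbreviation "img \<equiv> range ev"

lemma img_Z: "Z \<in> img"
proof -
  let ?g = "\<lambda>u. free_gen u :: (tetra_gen, 'k) free_alg"
  have "ev (?g gen_c * ?g gen_b + ?g gen_b * ?g gen_a + ?g gen_a * ?g gen_c - free_const \<alpha>2) = Z"
    unfolding gens_Z[symmetric] by (simp add: ev_simps)
  then show ?thesis by (metis rangeI)
qed

text \<open>All blocks of \<open>Z\<close> are multiples of \<open>l\<close>, so the entries of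
  \<open>Z M Z\<close> are multiples of \<open>l^2 = 0\<close>, while the first block of
  \<open>Z\<close> is \<open>l\<close> itself.\<close>

lemma not_semisimple_if_l_nilpotent:
  assumes "l * l = 0" "l \<noteq> 0"
  shows "\<not> semisimple (T_algebra \<alpha>1 \<alpha>2 \<alpha>3)"
proof -
  obtain f where f: "ev f = Z" using img_Z by auto
  have l: "l * (l * r) = 0" for r using assms(1) by (simp add: mult.assoc[symmetric])
  have "Z * M * Z = 0" for M
  proof (cases M)
    case (Mat3 m1 m2 m3 m4 m5 m6 m7 m8 m9)
    have "Mat2 l 0 0 l * m * Mat2 l 0 0 l = 0" "Mat2 l 0 0 l * m * Mat2 (w*l) 0 0 (w*l) = 0" for m
      by (cases m; simp add: zero_mat2_def algebra_simps l assms)+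
    then show ?thesis unfolding Mat3
      by (cases m1; cases m2; cases m3; cases m4; cases m5; cases m6; cases m7; cases m8; cases m9)
        (simp add: Z_def zero_mat3_def zero_mat2_def algebra_simps l assms)
  qed
  moreover have "Z \<noteq> 0" using assms by (simp add: Z_def zero_mat3_def zero_mat2_def)
  ultimately show ?thesis using not_semisimple_T[of f] f by simp
qed

lemma img_add: "M \<in> img \<Longrightarrow> N \<in> img \<Longrightarrow> M + N \<in> img"
  by (elim imageE) (simp only: ev_add[symmetric] rangeI)
lemma img_mult: "M \<in> img \<Longrightarrow> N \<in> img \<Longrightarrow> M * N \<in> img"
  by (elim imageE) (simp only: ev_mult[symmetric] rangeI)
lemma img_e: "e r \<in> img"
  by (metis ev_const rangeI)
lemma img_scale: "M \<in> img \<Longrightarrow> e r * M \<in> img"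
  by (intro img_mult img_e)
lemma img_one: "1 \<in> img" using img_e[of 1] by (simp add: e_hom)

lemma img_gens: "A \<in> img" "D \<in> img"
proof -
  have "e 6 * gens u \<in> img" for u by (metis img_scale ev_gen rangeI)
  moreover have "e 6 * (e (1 / 6) * M) = M" for M
    using six by (simp add: mult.assoc[symmetric] e_hom(3) flip: e_hom(2))
  ultimately show "A \<in> img" "D \<in> img" by (metis gens_def tetra_gen.case)+
qed

end

section \<open>The image of the representation\<close>

definition blk :: "nat \<Rightarrow> nat \<Rightarrow> 'r mat2 \<Rightarrow> 'r::ring_1 mat2 mat3" where
  "blk i j N = (let f = (\<lambda>k m. if i = k \<and> j = m then N else 0) in
    Mat3 (f 0 0) (f 0 1) (f 0 2) (f 1 0) (f 1 1) (f 1 2) (f 2 0) (f 2 1) (f 2 2))"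

lemma less_3_cases: "i < (3::nat) \<longleftrightarrow> i = 0 \<or> i = 1 \<or> i = 2" by auto

lemma blk_simps:
  "blk 0 0 N = Mat3 N 0 0 0 0 0 0 0 0" "blk 0 1 N = Mat3 0 N 0 0 0 0 0 0 0" "blk 0 2 N = Mat3 0 0 N 0 0 0 0 0 0"
  "blk 1 0 N = Mat3 0 0 0 N 0 0 0 0 0" "blk 1 1 N = Mat3 0 0 0 0 N 0 0 0 0" "blk 1 2 N = Mat3 0 0 0 0 0 N 0 0 0"
  "blk 2 0 N = Mat3 0 0 0 0 0 0 N 0 0" "blk 2 1 N = Mat3 0 0 0 0 0 0 0 N 0" "blk 2 2 N = Mat3 0 0 0 0 0 0 0 0 N"
  by (simp_all add: blk_def)

lemma blk_add: "blk i j (M + N) = blk i j M + blk i j N"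
  by (simp add: blk_def)

lemma blk_mult: "i < 3 \<Longrightarrow> j < 3 \<Longrightarrow> k < 3 \<Longrightarrow> blk i j M * blk j k N = blk i k (M * N)"
  unfolding less_3_cases by (elim disjE) (simp_all only: blk_simps mat3_simps, simp_all)

lemma blk_corner: "blk 0 0 1 * Mat3 a b c d e f g h i * blk 0 0 1 = blk 0 0 a"
  "blk 0 0 1 * Mat3 a b c d e f g h i * blk 1 1 1 = blk 0 1 b"
  "blk 0 0 1 * Mat3 a b c d e f g h i * blk 2 2 1 = blk 0 2 c"
  "blk 1 1 1 * Mat3 a b c d e f g h i * blk 0 0 1 = blk 1 0 d"
  "blk 1 1 1 * Mat3 a b c d e f g h i * blk 1 1 1 = blk 1 1 e"
  "blk 1 1 1 * Mat3 a b c d e f g h i * blk 2 2 1 = blk 1 2 f"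
  "blk 2 2 1 * Mat3 a b c d e f g h i * blk 0 0 1 = blk 2 0 g"
  "blk 2 2 1 * Mat3 a b c d e f g h i * blk 1 1 1 = blk 2 1 h"
  "blk 2 2 1 * Mat3 a b c d e f g h i * blk 2 2 1 = blk 2 2 i"
  by (simp_all only: blk_simps mat3_simps, simp_all)

lemma mat3_sum_blk: "Mat3 a b c d e f g h i = blk 0 0 a + blk 0 1 b + blk 0 2 c
    + blk 1 0 d + blk 1 1 e + blk 1 2 f + blk 2 0 g + blk 2 1 h + blk 2 2 i"
  by (simp only: blk_simps mat3_simps, simp)

context tetra_rep
begin

text \<open>Products along the closed paths through the three blocks isolate \<open>n\<close>.\<close>

lemma path_0: "H1 * H0 * H2 = Mat2 (l + q) 0 0 (l + q) * H0 + Mat2 0 (3 * l) 0 0"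
  by (simp add: gen_defs algebra_simps w w' xx xx' lwy lwy' ly ly')
lemma path_1: "H2 * H1 * H0 = Mat2 (w * l + q) 0 0 (w * l + q) * H1 + Mat2 0 (- 3 * l - 3 * (w * l)) 0 0"
  by (simp add: gen_defs algebra_simps w w' xx xx' lwy lwy' ly ly')
lemma path_2: "H0 * H2 * H1 = Mat2 (- l - w * l + q) 0 0 (- l - w * l + q) * H2 + Mat2 0 (3 * (w * l)) 0 0"
  by (simp add: gen_defs algebra_simps w w' xx xx' lwy lwy' ly ly')

end

text \<open>For invertible \<open>l\<close> one can take \<open>t = 0\<close>. Then
  \<open>v = p / l\<close> and \<open>y = p q / l^2\<close>, and the remaining condition on
  \<open>x\<close> becomes \<open>(l x)^2 = l^3 + p q^2\<close>.\<close>

locale tetra_rep_unit = tetra_rep_alg emb \<alpha>1 \<alpha>2 \<alpha>3 \<omega> x y t v l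
  for emb :: "'k::field \<Rightarrow> 'r::comm_ring_1" and \<alpha>1 \<alpha>2 \<alpha>3 \<omega> x y t v l +
  fixes \<mu> :: 'k
  assumes l_eq: "l = emb \<mu>" and mu: "\<mu> \<noteq> 0" and t_eq: "t = 0"
begin

text \<open>Peirce components: once the diagonal block idempotents lie in the image, the image is
  the sum of these nine pieces.\<close>

definition "Q i j = {N. blk i j N \<in> img}"

lemma Q_add: "M \<in> Q i j \<Longrightarrow> N \<in> Q i j \<Longrightarrow> M + N \<in> Q i j"
  by (simp add: Q_def blk_add img_add)

lemma Q_mult: "M \<in> Q i j \<Longrightarrow> N \<in> Q j k \<Longrightarrow> i < 3 \<Longrightarrow> j < 3 \<Longrightarrow> k < 3 \<Longrightarrow> M * N \<in> Q i k"
  unfolding Q_def using img_mult[of "blk i j M" "blk j k N"] by (simp add: blk_mult)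

lemma e_blk: "e r * blk i j N = blk i j (Mat2 (emb r) 0 0 (emb r) * N)"
  by (simp add: blk_def e_def Let_def)

lemma Q_scale: "N \<in> Q i j \<Longrightarrow> Mat2 (emb r) 0 0 (emb r) * N \<in> Q i j"
  unfolding Q_def using img_scale[of "blk i j N" r] by (simp add: e_blk)

lemma Q_minus: "N \<in> Q i j \<Longrightarrow> - N \<in> Q i j"
proof -
  have "Mat2 (emb (- 1)) 0 0 (emb (- 1)) * N = - N"
    by (cases N) (simp add: emb_minus emb_one)
  then show "N \<in> Q i j \<Longrightarrow> - N \<in> Q i j" using Q_scale[of N i j "- 1"] by simp
qed

lemma Q_diff: "M \<in> Q i j \<Longrightarrow> N \<in> Q i j \<Longrightarrow> M - N \<in> Q i j"
  using Q_add[of M i j "- N"] Q_minus by simp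

lemma Q_unscale: "Mat2 (emb r) 0 0 (emb r) * N \<in> Q i j \<Longrightarrow> r \<noteq> 0 \<Longrightarrow> N \<in> Q i j"
proof -
  assume r: "r \<noteq> 0"
  have "Mat2 (emb (1 / r)) 0 0 (emb (1 / r)) * (Mat2 (emb r) 0 0 (emb r) * N) = N"
    using r by (cases N) (simp add: mult.assoc[symmetric] emb_one flip: emb_mult)
  then show "Mat2 (emb r) 0 0 (emb r) * N \<in> Q i j \<Longrightarrow> N \<in> Q i j"
    using Q_scale[of "Mat2 (emb r) 0 0 (emb r) * N" i j "1 / r"] by simp
qed

lemma three: "(3::'k) \<noteq> 0" and two: "(2::'k) \<noteq> 0"
proof -
  have "(6::'k) = 2 * 3" by simp
  then show "(3::'k) \<noteq> 0" "(2::'k) \<noteq> 0" using six by (metis mult_zero_right, metis mult_zero_left)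
qed

lemma mu_inv: "emb (1 / \<mu>) * l = 1" "emb (1 / \<mu>) * (l * r) = r"
  "l * emb (1 / \<mu>) = 1" "l * (r * emb (1 / \<mu>)) = r"
proof -
  show 1: "emb (1 / \<mu>) * l = 1" using mu by (simp add: l_eq emb_one flip: emb_mult)
  show "emb (1 / \<mu>) * (l * r) = r" using 1 by (metis mult.assoc mult_1_left)
  then show "l * (r * emb (1 / \<mu>)) = r" by (simp add: ac_simps)
  show "l * emb (1 / \<mu>) = 1" using 1 by (simp add: mult.commute)
qed

text \<open>\<open>Z / l\<close> is \<open>D = diag(1, w, w^2)\<close>, and the projections onto its
  blocks are \<open>(1 + w^-i D + w^-2i D^2) / 3\<close>.\<close>

lemma img_diag: "blk i i 1 \<in> img" if "i < 3"
proof -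
  let ?D = "e (1 / \<mu>) * Z"
  have D: "?D = Mat3 1 0 0 0 (Mat2 w 0 0 w) 0 0 0 (Mat2 (- 1 - w) 0 0 (- 1 - w))"
    by (simp add: Z_def e_def Let_def mu_inv one_mat2_def algebra_simps)
  have img: "?D \<in> img" "?D * ?D \<in> img" by (intro img_mult img_scale img_Z img_e)+
  have "e (1 / 3) * (1 + e a * ?D + e b * (?D * ?D)) \<in> img" for a b
    by (intro img_scale img_add img_one img)
  note this[of 1 1] this[of "- 1 - \<omega>" \<omega>] this[of \<omega> "- 1 - \<omega>"]
  moreover have "emb (1 / 3) * 3 = 1"
    using three by (simp add: emb_one flip: emb_numeral emb_mult)
  then have third: "3 * emb (1 / 3) = 1" "emb (1 / 3) + (emb (1 / 3) + emb (1 / 3)) = 1"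
    by (simp_all add: algebra_simps)
  have "e (1 / 3) * (1 + e 1 * ?D + e 1 * (?D * ?D)) = blk 0 0 1"
       "e (1 / 3) * (1 + e (- 1 - \<omega>) * ?D + e \<omega> * (?D * ?D)) = blk 1 1 1"
       "e (1 / 3) * (1 + e \<omega> * ?D + e (- 1 - \<omega>) * (?D * ?D)) = blk 2 2 1"
    unfolding D blk_simps by (simp_all add: e_def Let_def one_mat3_def one_mat2_def zero_mat2_def emb_minus emb_diff emb_one
       algebra_simps w w' third)
  ultimately show ?thesis using that unfolding less_3_cases by auto
qed

lemma Q_corner: assumes "M \<in> img"
  shows "f11 M \<in> Q 0 0" "f12 M \<in> Q 0 1" "f13 M \<in> Q 0 2" "f21 M \<in> Q 1 0" "f22 M \<in> Q 1 1" "f23 M \<in> Q 1 2"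
    "f31 M \<in> Q 2 0" "f32 M \<in> Q 2 1" "f33 M \<in> Q 2 2"
proof -
  have "blk i i 1 * M * blk j j 1 \<in> img" if "i < 3" "j < 3" for i j
    using that by (intro img_mult img_diag assms)
  note this[of 0 0] this[of 0 1] this[of 0 2] this[of 1 0] this[of 1 1] this[of 1 2] this[of 2 0] this[of 2 1] this[of 2 2]
  then show "f11 M \<in> Q 0 0" "f12 M \<in> Q 0 1" "f13 M \<in> Q 0 2" "f21 M \<in> Q 1 0" "f22 M \<in> Q 1 1" "f23 M \<in> Q 1 2"
    "f31 M \<in> Q 2 0" "f32 M \<in> Q 2 1" "f33 M \<in> Q 2 2"
    by (cases M; simp add: Q_def blk_corner[simplified])+
qed

lemma two_mat2: "(2::'r mat2) * N = Mat2 (emb 2) 0 0 (emb 2) * N" "(3::'r mat2) * N = Mat2 (emb 3) 0 0 (emb 3) * N"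
  by (simp_all add: numeral_mat2 emb_numeral)

text \<open>The off-diagonal blocks of \<open>A\<close> are \<open>2 H\<^sub>k\<close>. On the
  diagonal, \<open>A\<close> and \<open>D\<close> have \<open>3 tau - H\<^sub>i\<close> and
  \<open>3 tau + 3 H\<^sub>i\<close>, with difference \<open>4 H\<^sub>i\<close>; the factors 2, 3
  and 4 are invertible.\<close>

lemma Q_H: "H0 \<in> Q 0 0" "H2 \<in> Q 0 1" "H1 \<in> Q 0 2" "H2 \<in> Q 1 0" "H1 \<in> Q 1 1" "H0 \<in> Q 1 2"
    "H1 \<in> Q 2 0" "H0 \<in> Q 2 1" "H2 \<in> Q 2 2" and Q_tau: "tau \<in> Q 0 0" "tau \<in> Q 1 1" "tau \<in> Q 2 2"
proof -
  note A = Q_corner[OF img_gens(1), unfolded A_def mat3.sel]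
  note D = Q_corner[OF img_gens(2), unfolded D_def mat3.sel]
  note un = Q_unscale[OF _ two] Q_unscale[OF _ three]
  show "H2 \<in> Q 0 1" "H1 \<in> Q 0 2" "H2 \<in> Q 1 0" "H0 \<in> Q 1 2" "H1 \<in> Q 2 0" "H0 \<in> Q 2 1"
    using A un(1) unfolding two_mat2 by blast+
  have four: "(4::'k) \<noteq> 0"
  proof -
    have "(4::'k) = 2 * 2" by simp
    then show ?thesis using two by (metis mult_eq_0_iff)
  qed
  have "Mat2 (emb 4) 0 0 (emb 4) * H \<in> Q i i \<and> tau \<in> Q i i"
    if "3 * tau - H \<in> Q i i" "3 * tau + 3 * H \<in> Q i i" for i H
  proof -
    have "(3 * tau + 3 * H) - (3 * tau - H) = Mat2 (emb 4) 0 0 (emb 4) * H"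
      by (cases H) (simp add: numeral_mat2 emb_numeral tau_def algebra_simps)
    then have 1: "Mat2 (emb 4) 0 0 (emb 4) * H \<in> Q i i" using Q_diff[OF that(2,1)] by simp
    then have "H \<in> Q i i" by (rule Q_unscale[OF _ four])
    from Q_add[OF that(1) this] have "tau \<in> Q i i" using un(2) by (simp add: two_mat2)
    with 1 show ?thesis by simp
  qed
  note this[OF A(1) D(1)] this[OF A(5) D(5)] this[OF A(9) D(9)]
  then show "H0 \<in> Q 0 0" "H1 \<in> Q 1 1" "H2 \<in> Q 2 2" "tau \<in> Q 0 0" "tau \<in> Q 1 1" "tau \<in> Q 2 2"
    using Q_unscale[OF _ four] by blast+
qed

text \<open>The path identities express a product of known blocks as a scalar multiple of
  \<open>H\<^sub>i\<close> plus a multiple of \<open>n\<close>. The coefficients of \<open>n\<close>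
  are 3 times \<open>\<mu>\<close> times a power of \<open>\<omega>\<close>, hence nonzero.\<close>

lemma Q_E12: "i < 3 \<Longrightarrow> Mat2 0 1 0 0 \<in> Q i i"
proof -
  have E12: "Mat2 0 1 0 0 \<in> Q i i"
    if "N \<in> Q i i" "H \<in> Q i i" "N = Mat2 (emb r) 0 0 (emb r) * H + Mat2 0 (emb k) 0 0" "k \<noteq> 0" for i N H r k
  proof (rule Q_unscale[OF _ \<open>k \<noteq> 0\<close>])
    have "N - Mat2 (emb r) 0 0 (emb r) * H \<in> Q i i" using that by (intro Q_diff Q_scale)
    then show "Mat2 (emb k) 0 0 (emb k) * Mat2 0 1 0 0 \<in> Q i i" using that by simp
  qed
  have om: "\<omega> \<noteq> 0" "- 1 - \<omega> \<noteq> 0" using omega by auto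
  have "Mat2 0 1 0 0 \<in> Q 0 0"
  proof (rule E12)
    show "H1 * H0 * H2 \<in> Q 0 0" by (intro Q_mult[of _ 0 1] Q_mult[of _ 0 2] Q_H) simp_all
    show "H1 * H0 * H2 = Mat2 (emb (\<mu> + (3 * \<alpha>1 - \<alpha>2))) 0 0 (emb (\<mu> + (3 * \<alpha>1 - \<alpha>2))) * H0 + Mat2 0 (emb (3 * \<mu>)) 0 0"
      unfolding path_0 by (simp add: emb_add emb_mult emb_numeral l_eq)
  qed (use Q_H mu three in auto)
  moreover have "Mat2 0 1 0 0 \<in> Q 1 1"
  proof (rule E12)
    show "H2 * H1 * H0 \<in> Q 1 1" by (intro Q_mult[of _ 1 2] Q_mult[of _ 1 0] Q_H) simp_all
    show "H2 * H1 * H0 = Mat2 (emb (\<omega> * \<mu> + (3 * \<alpha>1 - \<alpha>2))) 0 0 (emb (\<omega> * \<mu> + (3 * \<alpha>1 - \<alpha>2))) * H1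
        + Mat2 0 (emb (3 * \<mu> * (- 1 - \<omega>))) 0 0"
      unfolding path_1 by (simp add: emb_add emb_mult emb_numeral l_eq emb_diff emb_minus emb_one algebra_simps)
  qed (use Q_H mu three om in auto)
  moreover have "Mat2 0 1 0 0 \<in> Q 2 2"
  proof (rule E12)
    show "H0 * H2 * H1 \<in> Q 2 2" by (intro Q_mult[of _ 2 0] Q_mult[of _ 2 1] Q_H) simp_all
    show "H0 * H2 * H1 = Mat2 (emb (- \<mu> - \<omega> * \<mu> + (3 * \<alpha>1 - \<alpha>2))) 0 0 (emb (- \<mu> - \<omega> * \<mu> + (3 * \<alpha>1 - \<alpha>2))) * H2
        + Mat2 0 (emb (3 * (\<omega> * \<mu>))) 0 0"
      unfolding path_2 by (simp add: emb_add emb_mult emb_numeral l_eq emb_diff emb_minus emb_one)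
  qed (use Q_H mu three om in auto)
  ultimately show "i < 3 \<Longrightarrow> Mat2 0 1 0 0 \<in> Q i i" unfolding less_3_cases by blast
qed

text \<open>With matrix units written \<open>E11\<close> etc. and \<open>t = 0\<close>:
  \<open>n tau = l E11\<close>, \<open>tau n = l E22\<close> and \<open>E22 tau E11 = l E21\<close>,
  where \<open>l\<close> comes from a nonzero scalar.\<close>

lemma Q_E: assumes "i < 3"
  shows "Mat2 1 0 0 0 \<in> Q i i" "Mat2 0 0 0 1 \<in> Q i i" "Mat2 0 0 1 0 \<in> Q i i"
proof -
  have tau: "tau \<in> Q i i" using Q_tau assms unfolding less_3_cases by blast
  have "Mat2 (emb \<mu>) 0 0 (emb \<mu>) * Mat2 1 0 0 0 = Mat2 0 1 0 0 * tau"
    "Mat2 (emb \<mu>) 0 0 (emb \<mu>) * Mat2 0 0 0 1 = tau * Mat2 0 1 0 0"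
    unfolding tau_def by (simp_all add: l_eq t_eq)
  then show 1: "Mat2 1 0 0 0 \<in> Q i i" "Mat2 0 0 0 1 \<in> Q i i"
    using Q_unscale[OF _ mu] Q_mult[OF Q_E12 tau] Q_mult[OF tau Q_E12] assms by metis+
  have "Mat2 (emb \<mu>) 0 0 (emb \<mu>) * Mat2 0 0 1 0 = Mat2 0 0 0 1 * tau * Mat2 1 0 0 0"
    unfolding tau_def by (simp add: l_eq)
  then show "Mat2 0 0 1 0 \<in> Q i i"
    using Q_unscale[OF _ mu] Q_mult[OF Q_mult[OF 1(2) tau] 1(1)] assms by metis
qed

text \<open>Cutting \<open>H0\<close> down to its corner supplies the elements of the coefficient
  ring beyond the scalars of the field.\<close>

lemma Q_x: "Mat2 x 0 0 0 \<in> Q 0 0"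
proof -
  have "Mat2 1 0 0 0 * H0 * Mat2 1 0 0 0 \<in> Q 0 0" by (intro Q_mult[of _ 0 0] Q_E Q_H) simp_all
  then show ?thesis by (simp add: H0_def)
qed

text \<open>A product enclosed between two copies of \<open>x E11\<close> in the first block carries
  the factor \<open>x^2 = 0\<close>.\<close>

lemma not_semisimple_if_x_nilpotent:
  assumes "x * x = 0" "x \<noteq> 0"
  shows "\<not> semisimple (T_algebra \<alpha>1 \<alpha>2 \<alpha>3)"
proof -
  obtain f where f: "ev f = blk 0 0 (Mat2 x 0 0 0)" using Q_x by (auto simp: Q_def)
  have xr: "x * (x * r) = 0" for r using assms(1) by (simp add: mult.assoc[symmetric])
  have X: "Mat2 x 0 0 0 * m * Mat2 x 0 0 0 = 0" for m
    by (cases m) (simp add: zero_mat2_def algebra_simps xr assms)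
  have "blk 0 0 (Mat2 x 0 0 0) * M * blk 0 0 (Mat2 x 0 0 0) = 0" for M
    by (cases M) (simp add: blk_simps X zero_mat3_def)
  moreover have "blk 0 0 (Mat2 x 0 0 0) \<noteq> 0" using assms by (simp add: blk_simps zero_mat3_def zero_mat2_def)
  ultimately show ?thesis using not_semisimple_T[of f] f by simp
qed

text \<open>As 1 and \<open>x\<close> span the coefficient ring, the matrix units fill the first
  block. Units among the corner entries then spread this to the other blocks.\<close>

lemma surj_ev:
  assumes gen: "\<And>r. \<exists>a b. r = emb a + emb b * x" and unit: "x * u = 1"
  shows "surj ev"
proof -
  have E11: "Mat2 r 0 0 0 \<in> Q 0 0" for r
  proof -
    obtain a b where "r = emb a + emb b * x" using gen by blast
    then have "Mat2 r 0 0 0 = Mat2 (emb a) 0 0 (emb a) * Mat2 1 0 0 0 + Mat2 (emb b) 0 0 (emb b) * Mat2 x 0 0 0"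
      by simp
    also have "\<dots> \<in> Q 0 0" by (intro Q_add Q_scale Q_E Q_x) simp
    finally show ?thesis .
  qed
  have Q00: "N \<in> Q 0 0" for N
  proof (cases N)
    case (Mat2 a b c d)
    have "N = Mat2 a 0 0 0 + Mat2 b 0 0 0 * Mat2 0 1 0 0 + Mat2 0 0 1 0 * Mat2 c 0 0 0
        + Mat2 0 0 1 0 * Mat2 d 0 0 0 * Mat2 0 1 0 0"
      by (simp add: Mat2)
    also have "\<dots> \<in> Q 0 0" by (intro Q_add Q_mult[of _ 0 0] E11 Q_E Q_E12) simp_all
    finally show ?thesis .
  qed
  \<comment> \<open>The corner of \<open>H\<close> gives a unit multiple of \<open>E11\<close>;
    elements of \<open>Q 0 0\<close> on its right yield all first rows, and \<open>E21\<close> moves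
    them to the second row.\<close>
  have row: "N \<in> Q i 0" if i: "i < 3" and H: "H \<in> Q i 0" and g: "e11 H * g = 1" for i H g N
  proof (cases N)
    case (Mat2 a b c d)
    let ?G = "Mat2 1 0 0 0 * H * Mat2 1 0 0 0"
    have G: "?G = Mat2 (e11 H) 0 0 0" by (cases H) simp
    have "e11 H * (g * r) = r" for r using g by (metis mult.assoc mult_1_left)
    then have "N = ?G * Mat2 (g * a) (g * b) 0 0 + Mat2 0 0 1 0 * ?G * Mat2 (g * c) (g * d) 0 0"
      unfolding G by (simp add: Mat2)
    also have "\<dots> \<in> Q i 0"
      by (intro Q_add Q_mult[of _ i 0] Q_mult[of _ i i] Q_E H Q00 i) simp_all
    finally show ?thesis .
  qed
  have col: "N \<in> Q 0 i" if i: "i < 3" and H: "H \<in> Q 0 i" and g: "e11 H * g = 1" for i H g N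
  proof (cases N)
    case (Mat2 a b c d)
    let ?G = "Mat2 1 0 0 0 * H * Mat2 1 0 0 0"
    have G: "?G = Mat2 (e11 H) 0 0 0" by (cases H) simp
    have "r * g * e11 H = r" for r using g by (metis mult.assoc mult.commute mult_1_left)
    then have "N = Mat2 (a * g) 0 (c * g) 0 * ?G + Mat2 (b * g) 0 (d * g) 0 * (?G * Mat2 0 1 0 0)"
      unfolding G by (simp add: Mat2)
    also have "\<dots> \<in> Q 0 i"
      by (intro Q_add Q_mult[of _ 0 0 _ i] Q_mult[of _ 0 i _ i] Q_E Q_E12 H Q00 i) simp_all
    finally show ?thesis .
  qed
  \<comment> \<open>\<open>w (-1 - w) = w^3 = 1\<close> yields inverses of the corners
    \<open>w x\<close> of \<open>H2\<close> and \<open>w^2 x\<close> of \<open>H1\<close>.\<close>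
  have ww: "w * x * ((- 1 - w) * u) = 1" "(- x - w * x) * (w * u) = 1"
  proof -
    have "w * x * ((- 1 - w) * u) = (w * (- 1 - w)) * (x * u)" "(- x - w * x) * (w * u) = (w * (- 1 - w)) * (x * u)"
      by (simp_all add: algebra_simps)
    moreover have "w * (- 1 - w) = 1" by (simp add: algebra_simps w)
    ultimately show "w * x * ((- 1 - w) * u) = 1" "(- x - w * x) * (w * u) = 1" by (simp_all add: unit)
  qed
  have e11H: "e11 H2 = w * x" "e11 H1 = - x - w * x" by (simp_all add: H1_def H2_def)
  have 1: "N \<in> Q i 0" "N \<in> Q 0 i" if "i < 3" for i N
    using that row[of 1 H2] row[of 2 H1] col[of 1 H2] col[of 2 H1] Q_H ww Q00 unfolding less_3_cases e11H
    by (metis one_less_numeral_iff numeral_less_iff semiring_norm(76,77,78,79,80,81))+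
  \<comment> \<open>Factor \<open>N\<close> as \<open>N * 1\<close> with \<open>N\<close> in
    \<open>Q i 0\<close> and 1 in \<open>Q 0 j\<close>.\<close>
  have Q: "N \<in> Q i j" if "i < 3" "j < 3" for i j N
    using Q_mult[of N i 0 1 j] 1[OF that(1)] 1[OF that(2)] that by simp
  have "M \<in> img" for M
  proof (cases M)
    case (Mat3 m1 m2 m3 m4 m5 m6 m7 m8 m9)
    have "blk i j N \<in> img" if "i < 3" "j < 3" for i j N using Q[OF that] by (simp add: Q_def)
    then show ?thesis unfolding Mat3 mat3_sum_blk by (intro img_add) simp_all
  qed
  then show ?thesis by blast
qed

end

section \<open>Products of matrix algebras\<close>

text \<open>A criterion in terms of elements: it makes each \<open>R e\<close> a simple left ideal
  and places 1 in their sum.\<close>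

definition left_simple_frame :: "('a, 'm) ring_scheme \<Rightarrow> 'a set \<Rightarrow> bool" where
  "left_simple_frame R E \<longleftrightarrow> E \<subseteq> carrier R \<and> \<one>\<^bsub>R\<^esub> \<in> generate (add_monoid R) E \<and>
    (\<forall>e\<in>E. e \<noteq> \<zero>\<^bsub>R\<^esub> \<and> (\<forall>y\<in>carrier R. y \<otimes>\<^bsub>R\<^esub> e \<noteq> \<zero>\<^bsub>R\<^esub> \<longrightarrow>
      (\<exists>u\<in>carrier R. u \<otimes>\<^bsub>R\<^esub> (y \<otimes>\<^bsub>R\<^esub> e) = e)))"

lemma (in ring) generate_left_mult:
  assumes "y \<in> carrier R" "E \<subseteq> carrier R" "g \<in> generate (add_monoid R) E"
    and "\<And>e. e \<in> E \<Longrightarrow> y \<otimes> e \<in> F" "F \<subseteq> carrier R"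
  shows "y \<otimes> g \<in> generate (add_monoid R) F"
  using assms(3)
proof (induction rule: generate.induct)
  case one
  then show ?case using generate.one[of "add_monoid R" F] assms(1) by simp
next
  case (incl h)
  then show ?case using generate.incl[of "y \<otimes> h" F "add_monoid R"] assms by blast
next
  case (inv h)
  then have "h \<in> carrier R" using assms by blast
  then have "y \<otimes> (\<ominus> h) = \<ominus> (y \<otimes> h)" using assms by (simp add: r_minus)
  then show ?case using generate.inv[of "y \<otimes> h" F "add_monoid R"] inv assms by (simp add: a_inv_def[symmetric])
next
  case (eng h1 h2)
  have "h1 \<in> carrier R" "h2 \<in> carrier R"
    using eng.hyps group.generate_in_carrier[OF a_group, of E] assms(2) by auto
  then show ?case using generate.eng[OF eng.IH] assms(1) by (simp add: r_distr)
qed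

text \<open>A left ideal inside \<open>R e\<close> that has a nonzero element \<open>y e\<close>
  contains \<open>e\<close>, so \<open>R e\<close> is simple. Any \<open>y = y 1\<close> lies in the
  group generated by the products \<open>y e\<close>.\<close>

lemma semisimple_if_frame:
  assumes "ring R" and E: "left_simple_frame R E"
  shows "semisimple R"
proof -
  interpret ring R by fact
  have ER: "E \<subseteq> carrier R" and one: "\<one>\<^bsub>R\<^esub> \<in> generate (add_monoid R) E" using E by (auto simp: left_simple_frame_def)
  have frame: "\<And>e y. e \<in> E \<Longrightarrow> y \<in> carrier R \<Longrightarrow> y \<otimes>\<^bsub>R\<^esub> e \<noteq> \<zero>\<^bsub>R\<^esub> \<Longrightarrow>
      \<exists>u\<in>carrier R. u \<otimes>\<^bsub>R\<^esub> (y \<otimes>\<^bsub>R\<^esub> e) = e"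
    using E unfolding left_simple_frame_def by blast
  have simple: "simple_left_ideal {y \<otimes>\<^bsub>R\<^esub> e | y. y \<in> carrier R} R" (is "simple_left_ideal ?L R") if e: "e \<in> E" for e
  proof -
    have eR: "e \<in> carrier R" "e \<noteq> \<zero>\<^bsub>R\<^esub>" using e E by (auto simp: left_simple_frame_def)
    have eL: "e \<in> ?L" using eR by (auto intro!: exI[of _ "\<one>\<^bsub>R\<^esub>"])
    have li: "left_ideal ?L R"
      unfolding left_ideal_def
    proof (intro conjI ballI)
      show "additive_subgroup ?L R"
      proof (rule additive_subgroup.intro, rule a_group[THEN group.subgroupI])
        show "?L \<subseteq> carrier (add_monoid R)" using eR by auto
        show "?L \<noteq> {}" using eL by blast
        fix u assume "u \<in> ?L"
        then obtain r where r: "r \<in> carrier R" "u = r \<otimes>\<^bsub>R\<^esub> e" by auto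
        have "inv\<^bsub>add_monoid R\<^esub> u = (\<ominus>\<^bsub>R\<^esub> r) \<otimes>\<^bsub>R\<^esub> e"
          using r eR by (simp add: a_inv_def[symmetric] l_minus)
        then show "inv\<^bsub>add_monoid R\<^esub> u \<in> ?L" using r by auto
        fix v assume "v \<in> ?L"
        then obtain r' where r': "r' \<in> carrier R" "v = r' \<otimes>\<^bsub>R\<^esub> e" by auto
        have "u \<oplus>\<^bsub>R\<^esub> v = (r \<oplus>\<^bsub>R\<^esub> r') \<otimes>\<^bsub>R\<^esub> e" using r r' eR by (simp add: l_distr)
        then show "u \<otimes>\<^bsub>add_monoid R\<^esub> v \<in> ?L" using r r' by auto
      qed
      fix q u assume q: "q \<in> carrier R" and "u \<in> ?L"
      then obtain r where r: "r \<in> carrier R" "u = r \<otimes>\<^bsub>R\<^esub> e" by auto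
      have "q \<otimes>\<^bsub>R\<^esub> u = (q \<otimes>\<^bsub>R\<^esub> r) \<otimes>\<^bsub>R\<^esub> e" using q r eR by (simp add: m_assoc)
      then show "q \<otimes>\<^bsub>R\<^esub> u \<in> ?L" using q r by auto
    qed
    have "L' = {\<zero>\<^bsub>R\<^esub>} \<or> L' = ?L" if L': "left_ideal L' R" "L' \<subseteq> ?L" for L'
    proof (cases "L' \<subseteq> {\<zero>\<^bsub>R\<^esub>}")
      case True
      have "\<zero>\<^bsub>R\<^esub> \<in> L'" using L' by (auto simp: left_ideal_def additive_subgroup.zero_closed)
      then show ?thesis using True by auto
    next
      case False
      then obtain y where y: "y \<in> carrier R" "y \<otimes>\<^bsub>R\<^esub> e \<in> L'" "y \<otimes>\<^bsub>R\<^esub> e \<noteq> \<zero>\<^bsub>R\<^esub>" using L'(2) by blast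
      then obtain u where "u \<in> carrier R" "u \<otimes>\<^bsub>R\<^esub> (y \<otimes>\<^bsub>R\<^esub> e) = e"
        using frame[OF e] by blast
      then have "e \<in> L'" using L'(1) y unfolding left_ideal_def by metis
      then have "?L \<subseteq> L'" using L'(1) by (auto simp: left_ideal_def)
      then show ?thesis using L'(2) by blast
    qed
    then show ?thesis using li eL eR unfolding simple_left_ideal_def by blast
  qed
  have sub: "\<Union>{L. simple_left_ideal L R} \<subseteq> carrier R"
    using additive_subgroup.a_subset by (fastforce simp: simple_left_ideal_def left_ideal_def)
  have "y \<in> generate (add_monoid R) (\<Union>{L. simple_left_ideal L R})" if y: "y \<in> carrier R" for y
  proof -
    have "y \<otimes>\<^bsub>R\<^esub> \<one>\<^bsub>R\<^esub> \<in> generate (add_monoid R) (\<Union>{L. simple_left_ideal L R})"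
      by (rule generate_left_mult[OF y ER one _ sub]) (use simple y in blast)
    then show ?thesis using y by simp
  qed
  moreover have "generate (add_monoid R) (\<Union>{L. simple_left_ideal L R}) \<subseteq> carrier R"
    using group.generate_incl[OF a_group] sub by simp
  ultimately show ?thesis unfolding semisimple_def by blast
qed

text \<open>The criterion mentions only elements and ring operations; surjectivity of
  \<open>h\<close> lifts the multiplier \<open>y\<close>, and the multiplier \<open>u\<close> is
  carried forward.\<close>

lemma left_simple_frame_image:
  assumes R: "ring R" and S: "ring S" and h: "h \<in> ring_iso R S" and E: "left_simple_frame R E"
  shows "left_simple_frame S (h ` E)"
proof -
  interpret R: ring R by fact
  interpret S: ring S by fact
  have hom: "h \<in> Ring.ring_hom R S" and bij: "bij_betw h (carrier R) (carrier S)"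
    using h by (auto simp: ring_iso_def)
  interpret h: ring_hom_ring R S h by (rule ring_hom_ringI2[OF R S hom])
  have ER: "E \<subseteq> carrier R" using E by (auto simp: left_simple_frame_def)
  have frame: "\<And>e y. e \<in> E \<Longrightarrow> y \<in> carrier R \<Longrightarrow> y \<otimes>\<^bsub>R\<^esub> e \<noteq> \<zero>\<^bsub>R\<^esub> \<Longrightarrow>
      \<exists>u\<in>carrier R. u \<otimes>\<^bsub>R\<^esub> (y \<otimes>\<^bsub>R\<^esub> e) = e"
    using E unfolding left_simple_frame_def by blast
  interpret gh: group_hom "add_monoid R" "add_monoid S" h by (rule h.a_group_hom)
  have "\<one>\<^bsub>S\<^esub> \<in> generate (add_monoid S) (h ` E)"
  proof -
    have "\<one>\<^bsub>R\<^esub> \<in> generate (add_monoid R) E" using E by (simp add: left_simple_frame_def)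
    then have "h \<one>\<^bsub>R\<^esub> \<in> generate (add_monoid S) (h ` E)"
      using gh.generate_img[of E] ER by (simp only: partial_object.simps monoid.simps) (rule imageI)
    then show ?thesis by simp
  qed
  moreover have "h e \<noteq> \<zero>\<^bsub>S\<^esub> \<and> (\<forall>y\<in>carrier S. y \<otimes>\<^bsub>S\<^esub> h e \<noteq> \<zero>\<^bsub>S\<^esub> \<longrightarrow>
      (\<exists>u\<in>carrier S. u \<otimes>\<^bsub>S\<^esub> (y \<otimes>\<^bsub>S\<^esub> h e) = h e))" if e: "e \<in> E" for e
  proof (intro conjI ballI impI)
    have eR: "e \<in> carrier R" using e ER by blast
    show "h e \<noteq> \<zero>\<^bsub>S\<^esub>"
      using e E eR bij h.hom_zero R.zero_closed unfolding left_simple_frame_def bij_betw_def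
      by (metis inj_onD)
    fix y assume "y \<in> carrier S" and ye: "y \<otimes>\<^bsub>S\<^esub> h e \<noteq> \<zero>\<^bsub>S\<^esub>"
    then obtain x where x: "x \<in> carrier R" "y = h x" using bij by (auto simp: bij_betw_def)
    then have "x \<otimes>\<^bsub>R\<^esub> e \<noteq> \<zero>\<^bsub>R\<^esub>" using ye eR by (metis h.hom_mult h.hom_zero)
    then obtain u where u: "u \<in> carrier R" "u \<otimes>\<^bsub>R\<^esub> (x \<otimes>\<^bsub>R\<^esub> e) = e"
      using frame[OF e x(1)] by blast
    then have "h u \<otimes>\<^bsub>S\<^esub> (y \<otimes>\<^bsub>S\<^esub> h e) = h e" using x eR by (metis R.m_closed h.hom_mult)
    then show "\<exists>u\<in>carrier S. u \<otimes>\<^bsub>S\<^esub> (y \<otimes>\<^bsub>S\<^esub> h e) = h e"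
      using h.hom_closed[OF u(1)] by (rule bexI)
  qed
  ultimately show ?thesis using ER by (auto simp: left_simple_frame_def)
qed

lemma semisimple_iso:
  assumes "ring R" "ring S" "h \<in> ring_iso R S" "left_simple_frame S E"
  shows "semisimple R"
  using left_simple_frame_image[OF assms(2,1) ring_iso_set_sym[OF assms(1,3)] assms(4)]
    semisimple_if_frame[OF assms(1)] by blast

section \<open>Pairs of square matrices\<close>

abbreviation "mat_square n \<equiv> direct_product_algebra (matrix_algebra n) (matrix_algebra n)"

lemma mat_square_simps [simp]:
  "carrier (mat_square n) = carrier_mat n n \<times> carrier_mat n n"
  "(A, B) \<otimes>\<^bsub>mat_square n\<^esub> (A', B') = (A * A', B * B')"
  "(A, B) \<oplus>\<^bsub>mat_square n\<^esub> (A', B') = (A + A', B + B')"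
  "\<one>\<^bsub>mat_square n\<^esub> = (1\<^sub>m n, 1\<^sub>m n)" "\<zero>\<^bsub>mat_square n\<^esub> = (0\<^sub>m n n, 0\<^sub>m n n)"
  "r \<odot>\<^bsub>mat_square n\<^esub> (A, B) = (r \<cdot>\<^sub>m A, r \<cdot>\<^sub>m B)"
  by (simp_all add: direct_product_algebra_def matrix_algebra_def ring_mat_simps RDirProd_carrier)
     (simp_all add: RDirProd_def DirProd_def monoid.defs ring_mat_simps ring.defs ring_mat_def module.defs)

lemma ring_mat_square: "ring (mat_square n :: ('k::field, 'k mat \<times> 'k mat) module)"
  unfolding direct_product_algebra_def matrix_algebra_def
  by (intro ring_ring_extend RDirProd_ring ring_mat)

definition diag_unit :: "nat \<Rightarrow> nat \<Rightarrow> 'k::field mat" where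
  "diag_unit n j = Matrix.mat n n (\<lambda>(k, m). if k = j \<and> m = j then 1 else 0)"

text \<open>The product keeps only column \<open>j\<close> of \<open>P\<close>. If its entry in row
  \<open>i\<close> is nonzero, the matrix with the inverse of that entry at place
  \<open>(j, i)\<close> brings the column back to the diagonal unit.\<close>

lemma diag_unit_left_simple:
  assumes P: "P \<in> carrier_mat n n" and j: "j < n" and ne: "P * diag_unit n j \<noteq> 0\<^sub>m n n"
  shows "\<exists>U \<in> carrier_mat n n. U * (P * diag_unit n j) = (diag_unit n j :: 'k::field mat)"
proof -
  have PE: "P * diag_unit n j = Matrix.mat n n (\<lambda>(k, m). if m = j then P $$ (k, j) else 0)"
  proof (rule eq_matI)
    fix k m assume "k < dim_row (Matrix.mat n n (\<lambda>(k, m). if m = j then P $$ (k, j) else 0))"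
      "m < dim_col (Matrix.mat n n (\<lambda>(k, m). if m = j then P $$ (k, j) else 0))"
    then have km: "k < n" "m < n" by auto
    have "(P * diag_unit n j) $$ (k, m) = (\<Sum>i = 0..<n. P $$ (k, i) * (if i = j \<and> m = j then 1 else 0))"
      using P km by (simp add: diag_unit_def scalar_prod_def)
    also have "\<dots> = (\<Sum>i = 0..<n. if i = j then (if m = j then P $$ (k, j) else 0) else 0)"
      by (rule sum.cong) auto
    finally show "(P * diag_unit n j) $$ (k, m) = Matrix.mat n n (\<lambda>(k, m). if m = j then P $$ (k, j) else 0) $$ (k, m)"
      using km j by simp
  qed (use P in \<open>auto simp: diag_unit_def\<close>)
  have "\<exists>i<n. P $$ (i, j) \<noteq> 0"
  proof (rule ccontr)
    assume "\<not> (\<exists>i<n. P $$ (i, j) \<noteq> 0)"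
    then have "P * diag_unit n j = 0\<^sub>m n n" unfolding PE by (intro eq_matI) auto
    then show False using ne by simp
  qed
  then obtain i where i: "i < n" "P $$ (i, j) \<noteq> 0" by blast
  let ?U = "Matrix.mat n n (\<lambda>(k, m). if k = j \<and> m = i then inverse (P $$ (i, j)) else 0)"
  have "?U * (P * diag_unit n j) = diag_unit n j"
  proof (rule eq_matI)
    fix k m assume "k < dim_row (diag_unit n j :: 'k mat)" "m < dim_col (diag_unit n j :: 'k mat)"
    then have km: "k < n" "m < n" by (auto simp: diag_unit_def)
    have "(?U * (P * diag_unit n j)) $$ (k, m) = (\<Sum>h = 0..<n. (if k = j \<and> h = i then inverse (P $$ (i, j)) else 0)
        * (if m = j then P $$ (h, j) else 0))"
      unfolding PE using km by (simp add: scalar_prod_def)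
    also have "\<dots> = (\<Sum>h = 0..<n. if h = i then (if k = j \<and> m = j then 1 else 0) else 0)"
      by (rule sum.cong) (use i in auto)
    finally show "(?U * (P * diag_unit n j)) $$ (k, m) = diag_unit n j $$ (k, m)"
      using km i by (simp add: diag_unit_def)
  qed (auto simp: diag_unit_def PE)
  then show ?thesis by (intro bexI[of _ ?U]) auto
qed

lemma left_simple_frame_mat_square:
  "left_simple_frame (mat_square n :: ('k::field, 'k mat \<times> 'k mat) module)
    ((\<lambda>j. (diag_unit n j, 0\<^sub>m n n)) ` {..<n} \<union> (\<lambda>j. (0\<^sub>m n n, diag_unit n j)) ` {..<n})"
  (is "left_simple_frame ?R ?E")
proof -
  interpret ring ?R by (rule ring_mat_square)
  \<comment> \<open>The sum of the first \<open>m\<close> diagonal units; at \<open>m = n\<close> it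
    is the identity of one factor.\<close>
  let ?D = "\<lambda>m. Matrix.mat n n (\<lambda>(i, j). if i = j \<and> i < m then 1 else 0) :: 'k mat"
  have c: "diag_unit n j \<in> carrier_mat n n" for j by (simp add: diag_unit_def)
  have D0: "?D 0 = 0\<^sub>m n n" by auto
  have DS: "?D (Suc m) = ?D m + diag_unit n m" if "m < n" for m
    by (rule eq_matI) (use that in \<open>auto simp: diag_unit_def\<close>)
  have gen: "(?D m, 0\<^sub>m n n) \<in> generate (add_monoid ?R) ?E \<and> (0\<^sub>m n n, ?D m) \<in> generate (add_monoid ?R) ?E"
    if "m \<le> n" for m
    using that
  proof (induction m)
    case 0
    have "(0\<^sub>m n n, 0\<^sub>m n n) \<in> generate (add_monoid ?R) ?E"
      using generate.one[of "add_monoid ?R" ?E] by simp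
    then show ?case by (simp only: D0)
  next
    case (Suc m)
    then have m: "m < n" by simp
    have 1: "(diag_unit n m, 0\<^sub>m n n) \<in> generate (add_monoid ?R) ?E" "(0\<^sub>m n n, diag_unit n m) \<in> generate (add_monoid ?R) ?E"
      using m by (auto intro!: generate.incl)
    have IH: "(?D m, 0\<^sub>m n n) \<in> generate (add_monoid ?R) ?E" "(0\<^sub>m n n, ?D m) \<in> generate (add_monoid ?R) ?E"
      using Suc by auto
    have "(?D (Suc m), 0\<^sub>m n n) = (?D m, 0\<^sub>m n n) \<otimes>\<^bsub>add_monoid ?R\<^esub> (diag_unit n m, 0\<^sub>m n n)"
      "(0\<^sub>m n n, ?D (Suc m)) = (0\<^sub>m n n, ?D m) \<otimes>\<^bsub>add_monoid ?R\<^esub> (0\<^sub>m n n, diag_unit n m)"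
      by (simp_all add: DS[OF m])
    then show ?case using generate.eng[OF IH(1) 1(1)] generate.eng[OF IH(2) 1(2)] by (simp only:)
  qed
  have Dn: "?D n = 1\<^sub>m n" by (rule eq_matI) auto
  have "\<one>\<^bsub>?R\<^esub> = (?D n, 0\<^sub>m n n) \<otimes>\<^bsub>add_monoid ?R\<^esub> (0\<^sub>m n n, ?D n)"
    unfolding Dn by simp
  then have one: "\<one>\<^bsub>?R\<^esub> \<in> generate (add_monoid ?R) ?E"
    using gen[of n] generate.eng[of "(?D n, 0\<^sub>m n n)" "add_monoid ?R" ?E "(0\<^sub>m n n, ?D n)"] by (simp only:)
  have ne: "diag_unit n j \<noteq> (0\<^sub>m n n :: 'k mat)" if "j < n" for j
  proof
    assume "diag_unit n j = (0\<^sub>m n n :: 'k mat)"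
    then have "diag_unit n j $$ (j, j) = (0\<^sub>m n n :: 'k mat) $$ (j, j)" by simp
    then show False using that by (simp add: diag_unit_def)
  qed
  have z: "P * 0\<^sub>m n n = 0\<^sub>m n n" if "P \<in> carrier_mat n n" for P :: "'k mat" using that by simp
  have "e \<noteq> \<zero>\<^bsub>?R\<^esub> \<and> (\<forall>y\<in>carrier ?R. y \<otimes>\<^bsub>?R\<^esub> e \<noteq> \<zero>\<^bsub>?R\<^esub> \<longrightarrow>
      (\<exists>u\<in>carrier ?R. u \<otimes>\<^bsub>?R\<^esub> (y \<otimes>\<^bsub>?R\<^esub> e) = e))" if e: "e \<in> ?E" for e
  proof (intro conjI ballI impI)
    show "e \<noteq> \<zero>\<^bsub>?R\<^esub>" using e by (elim UnE imageE) (simp_all add: ne)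
    fix y assume y: "y \<in> carrier ?R" and nz: "y \<otimes>\<^bsub>?R\<^esub> e \<noteq> \<zero>\<^bsub>?R\<^esub>"
    obtain P P' where P: "y = (P, P')" "P \<in> carrier_mat n n" "P' \<in> carrier_mat n n" using y by auto
    from e consider j where "j < n" "e = (diag_unit n j, 0\<^sub>m n n)" | j where "j < n" "e = (0\<^sub>m n n, diag_unit n j)"
      by auto
    then show "\<exists>u\<in>carrier ?R. u \<otimes>\<^bsub>?R\<^esub> (y \<otimes>\<^bsub>?R\<^esub> e) = e"
    proof cases
      case (1 j)
      then obtain U where U: "U \<in> carrier_mat n n" "U * (P * diag_unit n j) = diag_unit n j"
        using diag_unit_left_simple[of P n j] P nz by (auto simp: z)
      then show ?thesis using 1 P by (intro bexI[of _ "(U, 0\<^sub>m n n)"]) (simp_all add: z)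
    next
      case (2 j)
      then obtain U where U: "U \<in> carrier_mat n n" "U * (P' * diag_unit n j) = diag_unit n j"
        using diag_unit_left_simple[of P' n j] P nz by (auto simp: z)
      then show ?thesis using 2 P by (intro bexI[of _ "(0\<^sub>m n n, U)"]) (simp_all add: z)
    qed
  qed
  then show ?thesis using one c unfolding left_simple_frame_def by auto
qed

section \<open>The isomorphism\<close>

definition ent2 :: "nat \<Rightarrow> nat \<Rightarrow> 'r mat2 \<Rightarrow> 'r" where
  "ent2 i j M = [[e11 M, e12 M], [e21 M, e22 M]] ! i ! j"

definition ent3 :: "nat \<Rightarrow> nat \<Rightarrow> 'r mat3 \<Rightarrow> 'r" where
  "ent3 i j M = [[f11 M, f12 M, f13 M], [f21 M, f22 M, f23 M], [f31 M, f32 M, f33 M]] ! i ! j"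

definition of_fun2 :: "(nat \<Rightarrow> nat \<Rightarrow> 'r) \<Rightarrow> 'r mat2" where
  "of_fun2 F = Mat2 (F 0 0) (F 0 1) (F 1 0) (F 1 1)"

definition of_fun3 :: "(nat \<Rightarrow> nat \<Rightarrow> 'r) \<Rightarrow> 'r mat3" where
  "of_fun3 F = Mat3 (F 0 0) (F 0 1) (F 0 2) (F 1 0) (F 1 1) (F 1 2) (F 2 0) (F 2 1) (F 2 2)"

lemma less_2_iff: "i < (2::nat) \<longleftrightarrow> i = 0 \<or> i = 1" by auto
lemma ent2_of_fun2: "i < 2 \<Longrightarrow> j < 2 \<Longrightarrow> ent2 i j (of_fun2 F) = F i j"
  unfolding less_2_iff by (elim disjE) (simp_all add: ent2_def of_fun2_def)

lemma ent3_of_fun3: "i < 3 \<Longrightarrow> j < 3 \<Longrightarrow> ent3 i j (of_fun3 F) = F i j"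
  unfolding less_3_cases by (elim disjE) (simp_all add: ent3_def of_fun3_def)

lemma ent2_eqI: "(\<And>i j. i < 2 \<Longrightarrow> j < 2 \<Longrightarrow> ent2 i j M = ent2 i j N) \<Longrightarrow> M = N"
proof -
  assume *: "\<And>i j. i < 2 \<Longrightarrow> j < 2 \<Longrightarrow> ent2 i j M = ent2 i j N"
  show "M = N" using *[of 0 0] *[of 0 1] *[of 1 0] *[of 1 1] by (simp add: ent2_def mat2.expand)
qed

lemma ent3_eqI: "(\<And>i j. i < 3 \<Longrightarrow> j < 3 \<Longrightarrow> ent3 i j M = ent3 i j N) \<Longrightarrow> M = N"
proof -
  assume *: "\<And>i j. i < 3 \<Longrightarrow> j < 3 \<Longrightarrow> ent3 i j M = ent3 i j N"
  show "M = N" using *[of 0 0] *[of 0 1] *[of 0 2] *[of 1 0] *[of 1 1] *[of 1 2] *[of 2 0] *[of 2 1] *[of 2 2]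
    by (simp add: ent3_def mat3.expand)
qed

lemma ent2_ring: assumes "i < 2" "j < 2"
  shows "ent2 i j (M + N) = ent2 i j M + ent2 i j N" "ent2 i j 1 = (if i = j then 1 else 0)"
    "ent2 i j (M * N) = ent2 i 0 M * ent2 0 j N + ent2 i 1 M * ent2 1 j N" "ent2 i j 0 = 0"
  using assms unfolding less_2_iff
  by (elim disjE; simp add: ent2_def plus_mat2_def times_mat2_def)+

lemma ent3_ring: assumes "i < 3" "j < 3"
  shows "ent3 i j (M + N) = ent3 i j M + ent3 i j N" "ent3 i j 1 = (if i = j then 1 else 0)"
    "ent3 i j (M * N) = ent3 i 0 M * ent3 0 j N + ent3 i 1 M * ent3 1 j N + ent3 i 2 M * ent3 2 j N"
  using assms unfolding less_3_cases
  by (elim disjE; simp add: ent3_def plus_mat3_def times_mat3_def one_mat3_def)+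

lemma ent_scal: assumes "i < 3" "j < 3" "k < 2" "m < 2"
  shows "ent2 k m (ent3 i j (scal r * M)) = r * ent2 k m (ent3 i j M)"
proof -
  have "ent3 i j (scal r * M) = Mat2 r 0 0 r * ent3 i j M"
    using assms(1,2) unfolding less_3_cases by (cases M; elim disjE; simp add: ent3_def Let_def)
  then show ?thesis using assms(3,4) unfolding less_2_iff by (elim disjE; simp add: ent2_def times_mat2_def)
qed

text \<open>Row or column \<open>i\<close> of the flattened matrix is place \<open>i mod 2\<close>
  in block \<open>i div 2\<close>. The map \<open>\<pi>\<close> is meant as a ring homomorphism to
  the field, here a projection of the pairs.\<close>

definition flat_mat :: "('r \<Rightarrow> 'k::field) \<Rightarrow> 'r mat2 mat3 \<Rightarrow> 'k mat" where
  "flat_mat \<pi> M = Matrix.mat 6 6 (\<lambda>(i, j). \<pi> (ent2 (i mod 2) (j mod 2) (ent3 (i div 2) (j div 2) M)))"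

lemma flat_mat_carrier: "flat_mat \<pi> M \<in> carrier_mat 6 6"
  by (simp add: flat_mat_def)

lemma flat_mat_ring:
  fixes \<pi> :: "'r::comm_ring_1 \<Rightarrow> 'k::field"
  assumes add: "\<And>a b. \<pi> (a + b) = \<pi> a + \<pi> b" and mult: "\<And>a b. \<pi> (a * b) = \<pi> a * \<pi> b" and one: "\<pi> 1 = 1"
  shows "flat_mat \<pi> (M + N) = flat_mat \<pi> M + flat_mat \<pi> N" "flat_mat \<pi> 1 = 1\<^sub>m 6"
    "flat_mat \<pi> (M * N) = flat_mat \<pi> M * flat_mat \<pi> N" "flat_mat \<pi> (scal r * M) = \<pi> r \<cdot>\<^sub>m flat_mat \<pi> M"
proof -
  have zero: "\<pi> 0 = 0" by (metis add add.right_neutral add_left_cancel)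
  have b: "i div 2 < 3" "i mod 2 < 2" if "i < 6" for i :: nat using that by auto
  have b1: "0 < (2::nat)" "1 < (2::nat)" "0 < (3::nat)" "1 < (3::nat)" "2 < (3::nat)" by simp_all
  show "flat_mat \<pi> (scal r * M) = \<pi> r \<cdot>\<^sub>m flat_mat \<pi> M"
    by (rule eq_matI) (simp_all add: ent_scal b mult flat_mat_def)
  note [simp] = ent2_ring ent3_ring b add mult one zero flat_mat_def
  show "flat_mat \<pi> (M + N) = flat_mat \<pi> M + flat_mat \<pi> N"
    by (rule eq_matI; simp)
  show "flat_mat \<pi> 1 = 1\<^sub>m 6"
  proof (rule eq_matI)
    fix i j assume "i < dim_row (1\<^sub>m 6 :: 'k mat)" "j < dim_col (1\<^sub>m 6 :: 'k mat)"
    moreover have "i = j \<longleftrightarrow> i div 2 = j div 2 \<and> i mod 2 = j mod 2" by (metis div_mult_mod_eq)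
    ultimately show "flat_mat \<pi> 1 $$ (i, j) = 1\<^sub>m 6 $$ (i, j)" by simp
  qed simp_all
  show "flat_mat \<pi> (M * N) = flat_mat \<pi> M * flat_mat \<pi> N"
  proof (rule eq_matI)
    fix i j assume "i < dim_row (flat_mat \<pi> M * flat_mat \<pi> N)" "j < dim_col (flat_mat \<pi> M * flat_mat \<pi> N)"
    then have ij: "i < 6" "j < 6" by simp_all
    have "{0..<6::nat} = {0, 1, 2, 3, 4, 5}" by auto
    then have "(flat_mat \<pi> M * flat_mat \<pi> N) $$ (i, j) = (\<Sum>k\<in>{0, 1, 2, 3, 4, 5}.
        \<pi> (ent2 (i mod 2) (k mod 2) (ent3 (i div 2) (k div 2) M)) * \<pi> (ent2 (k mod 2) (j mod 2) (ent3 (k div 2) (j div 2) N)))"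
      using ij by (simp add: scalar_prod_def)
    also have "\<dots> = flat_mat \<pi> (M * N) $$ (i, j)"
      using ij b1 by (simp add: algebra_simps)
    finally show "flat_mat \<pi> (M * N) $$ (i, j) = (flat_mat \<pi> M * flat_mat \<pi> N) $$ (i, j)" ..
  qed simp_all
qed

lemma split_simps [simp]:
  "fst_s (a + b) = fst_s a + fst_s b" "snd_s (a + b) = snd_s a + snd_s b"
  "fst_s (a * b) = fst_s a * fst_s b" "snd_s (a * b) = snd_s a * snd_s b"
  "fst_s 1 = 1" "snd_s 1 = 1" "fst_s 0 = 0" "snd_s 0 = 0"
  by (simp_all add: split_defs)

definition to_mats :: "'k::field split mat2 mat3 \<Rightarrow> 'k mat \<times> 'k mat" where
  "to_mats M = (flat_mat fst_s M, flat_mat snd_s M)"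

lemma to_mats_ring:
  "to_mats (M + N) = to_mats M \<oplus>\<^bsub>mat_square 6\<^esub> to_mats N" "to_mats 1 = \<one>\<^bsub>mat_square 6\<^esub>"
  "to_mats (M * N) = to_mats M \<otimes>\<^bsub>mat_square 6\<^esub> to_mats N"
  "to_mats M \<in> carrier (mat_square 6)"
  unfolding to_mats_def by (simp_all add: flat_mat_ring flat_mat_carrier)

lemma to_mats_scal: "to_mats (scal (Split r r) * M) = r \<odot>\<^bsub>mat_square 6\<^esub> to_mats M"
  unfolding to_mats_def by (simp add: flat_mat_ring(4))

lemma inj_to_mats: "inj (to_mats :: 'k::field split mat2 mat3 \<Rightarrow> _)"
proof (rule injI)
  fix M N :: "'k split mat2 mat3" assume *: "to_mats M = to_mats N"
  show "M = N"
  proof (rule ent3_eqI, rule ent2_eqI)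
    fix i j k m :: nat assume ij: "i < 3" "j < 3" and km: "k < 2" "m < 2"
    let ?r = "\<lambda>M. ent2 k m (ent3 i j M)"
    have "2 * i + k < 6" "2 * j + m < 6" using ij km by auto
    moreover have "(2 * i + k) div 2 = i" "(2 * j + m) div 2 = j" "(2 * i + k) mod 2 = k" "(2 * j + m) mod 2 = m"
      using km by auto
    moreover have "flat_mat fst_s M $$ (2 * i + k, 2 * j + m) = flat_mat fst_s N $$ (2 * i + k, 2 * j + m)"
      "flat_mat snd_s M $$ (2 * i + k, 2 * j + m) = flat_mat snd_s N $$ (2 * i + k, 2 * j + m)"
      using * by (simp_all add: to_mats_def)
    ultimately have "fst_s (?r M) = fst_s (?r N)" "snd_s (?r M) = snd_s (?r N)"
      by (simp_all add: flat_mat_def)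
    then show "?r M = ?r N" by (rule split.expand[OF conjI])
  qed
qed

lemma to_mats_surj:
  assumes "P \<in> carrier_mat 6 6" "P' \<in> carrier_mat 6 6"
  shows "\<exists>M. to_mats M = (P, P')"
proof -
  let ?M = "of_fun3 (\<lambda>i j. of_fun2 (\<lambda>k m. Split (P $$ (2 * i + k, 2 * j + m)) (P' $$ (2 * i + k, 2 * j + m))))"
  have b: "i div 2 < 3" "i mod 2 < 2" "2 * (i div 2) + i mod 2 = i" if "i < 6" for i :: nat using that by auto
  have "to_mats ?M = (P, P')"
    unfolding to_mats_def prod.inject
    by (intro conjI eq_matI) (use assms in \<open>auto simp: flat_mat_def ent3_of_fun3 ent2_of_fun2 b\<close>)
  then show ?thesis by blast
qed

definition split_const :: "'k::field \<Rightarrow> 'k split mat2 mat3" where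
  "split_const r = scal (Split r r)"

text \<open>The index type only serves to have 72 elements, two times 6 by 6.\<close>

definition index6 :: "bool \<times> bool option \<Rightarrow> nat" where
  "index6 = (\<lambda>(b, c). (case c of None \<Rightarrow> 0 | Some False \<Rightarrow> 2 | Some True \<Rightarrow> 4) + (if b then 1 else 0))"

text \<open>Lists the entries of both matrices as one vector, so that the dimension count
  applies.\<close>

definition coords :: "'k::field split mat2 mat3 \<Rightarrow>
    ('k, bool \<times> (bool \<times> bool option) \<times> (bool \<times> bool option)) Finite_Cartesian_Product.vec" where
  "coords M = (\<chi> p. case p of (s, i, j) \<Rightarrow>
    (if s then fst (to_mats M) else snd (to_mats M)) $$ (index6 i, index6 j))"

lemma index6_less: "index6 i < 6"
  by (auto simp: index6_def split: option.splits bool.splits prod.splits)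

lemma inj_index6: "inj index6"
  by (auto simp: index6_def inj_def split: option.splits bool.splits if_splits)

lemma coords_nth: "vec_nth (coords M) (s, i, j) = (if s then fst_s else snd_s)
    (ent2 (index6 i mod 2) (index6 j mod 2) (ent3 (index6 i div 2) (index6 j div 2) M))"
  using index6_less by (simp add: coords_def to_mats_def flat_mat_def)

lemma index6_bounds: "index6 i div 2 < 3" "index6 i mod 2 < 2"
  using index6_less[of i] by auto

lemma coords_add: "coords (M + N) = coords M + coords N"
  by (simp add: Finite_Cartesian_Product.vec_eq_iff coords_nth ent2_ring ent3_ring index6_bounds split_paired_all)

lemma coords_scal: "coords (scal (Split r r) * M) = r *s coords M"
  by (simp add: Finite_Cartesian_Product.vec_eq_iff coords_nth ent_scal index6_bounds split_paired_all)

lemma surj_coords: "surj (coords :: 'k::field split mat2 mat3 \<Rightarrow> _)"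
proof (rule surjI)
  fix v :: "('k, bool \<times> (bool \<times> bool option) \<times> (bool \<times> bool option)) Finite_Cartesian_Product.vec"
  let ?P = "\<lambda>s. Matrix.mat 6 6 (\<lambda>(i, j). vec_nth v (s, the_inv index6 i, the_inv index6 j))"
  have "\<exists>M. to_mats M = (?P True, ?P False)" by (rule to_mats_surj) simp_all
  then have M: "to_mats (SOME M. to_mats M = (?P True, ?P False)) = (?P True, ?P False)" by (rule someI_ex)
  show "coords (SOME M. to_mats M = (?P True, ?P False)) = v"
    using index6_less by (auto simp: coords_def M Finite_Cartesian_Product.vec_eq_iff the_inv_f_f[OF inj_index6] split: prod.splits)
qed

lemma card_coords: "CARD(bool \<times> (bool \<times> bool option) \<times> (bool \<times> bool option)) = 72"
  by (simp add: card_UNIV_option)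

lemma coords_zero: "coords 0 = 0"
  using coords_add[of 0 0] by simp

context
  fixes g :: "tetra_gen \<Rightarrow> 'k::field split mat2 mat3" and \<alpha>1 \<alpha>2 \<alpha>3 :: 'k
  assumes eval: "T_evaluation split_const g \<alpha>1 \<alpha>2 \<alpha>3" and surj: "surj (word_eval split_const g)"
begin

interpretation T_evaluation split_const g \<alpha>1 \<alpha>2 \<alpha>3 by (rule eval)

text \<open>The quotient is spanned by 72 words and maps onto a space of dimension 72, which leaves
  no room for a larger kernel.\<close>

lemma ev_zero_iff: "ev f = 0 \<longleftrightarrow> f \<in> T_ideal \<alpha>1 \<alpha>2 \<alpha>3"
proof
  interpret tetra_relations "T_ideal \<alpha>1 \<alpha>2 \<alpha>3" free_const \<alpha>1 \<alpha>2 \<alpha>3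
    "free_gen gen_a" "free_gen gen_b" "free_gen gen_c" "free_gen gen_d"
    by (rule tetra_relations_T_ideal)
  assume "ev f = 0"
  then show "f \<in> T_ideal \<alpha>1 \<alpha>2 \<alpha>3"
  proof (intro kernel_subset_I[where h = "coords \<circ> ev"])
    show "surj (coords \<circ> ev)" using surj surj_coords by (rule comp_surj)
  qed (simp_all add: ev_simps coords_add split_const_def coords_scal T_ideal_kernel coords_zero T_span_UNIV card_coords)
qed (rule T_ideal_kernel)

abbreviation "\<psi> \<equiv> \<lambda>f. to_mats (ev f)"

text \<open>First isomorphism theorem for the ring structure; scalars are checked on cosets, where
  the union over representatives collapses to a single coset.\<close>

lemma T_algebra_iso: "(\<lambda>X. the_elem (\<psi> ` X)) \<in> algebra_iso (T_algebra \<alpha>1 \<alpha>2 \<alpha>3) (mat_square 6)"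
proof -
  let ?A = "free_algebra :: ('k, (tetra_gen, 'k) free_alg) module" and ?S = "mat_square 6 :: ('k, 'k mat \<times> 'k mat) module"
  let ?I = "T_ideal \<alpha>1 \<alpha>2 \<alpha>3" and ?h = "\<lambda>X. the_elem (\<psi> ` X)"
  have hom: "\<psi> \<in> Ring.ring_hom ?A ?S"
    by (rule ring_hom_memI) (simp_all only: free_algebra_simps ev_simps to_mats_ring)
  interpret h: ring_hom_ring ?A ?S \<psi>
    by (rule ring_hom_ringI2[OF free_algebra.ring_axioms ring_mat_square hom])
  have ker: "a_kernel ?A ?S \<psi> = ?I"
  proof -
    have "\<psi> f = \<zero>\<^bsub>?S\<^esub> \<longleftrightarrow> ev f = 0" for f
      using h.hom_zero inj_to_mats ev_zero by (metis free_algebra_simps(5) injD)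
    then show ?thesis
      unfolding a_kernel_def' by (simp only: ev_zero_iff free_algebra_simps UNIV_I simp_thms Collect_mem_eq)
  qed
  have img: "\<psi> ` carrier ?A = carrier ?S"
  proof -
    have "\<exists>f. \<psi> f = (P, P')" if "P \<in> carrier_mat 6 6" "P' \<in> carrier_mat 6 6" for P P'
      using to_mats_surj[OF that] surj by (metis surjD)
    then have "\<exists>f. y = \<psi> f" if "y \<in> carrier ?S" for y
      using that by (cases y) (metis SigmaE2 mat_square_simps(1))
    then show ?thesis using to_mats_ring(4) by (intro subset_antisym subsetI) (blast, metis free_algebra_simps(1) UNIV_I image_eqI)
  qed
  have iso: "?h \<in> ring_iso (?A Quot ?I) ?S"
    using h.FactRing_iso_set[OF img] unfolding ker .
  then have "?h \<in> ring_iso (T_algebra \<alpha>1 \<alpha>2 \<alpha>3) ?S"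
    unfolding T_algebra_def quotient_algebra_def T_ideal_def[symmetric] ring_iso_def Ring.ring_hom_def by simp
  moreover have "?h (r \<odot>\<^bsub>T_algebra \<alpha>1 \<alpha>2 \<alpha>3\<^esub> X) = r \<odot>\<^bsub>?S\<^esub> ?h X" if X: "X \<in> carrier (T_algebra \<alpha>1 \<alpha>2 \<alpha>3)" for r X
  proof -
    interpret I: ideal ?I ?A by (rule ideal_T_ideal)
    have coset: "?I +>\<^bsub>?A\<^esub> f = {i + f | i. i \<in> ?I}" for f by (auto simp: a_r_coset_def')
    \<comment> \<open>\<open>\<psi>\<close> is constant on a coset, so \<open>the_elem\<close>
      returns its common value.\<close>
    have val: "?h (?I +>\<^bsub>?A\<^esub> f) = \<psi> f" for f
    proof -
      have "\<psi> ` (?I +>\<^bsub>?A\<^esub> f) = {\<psi> f}"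
        unfolding coset using ideal_free_algebraD(1)[OF ideal_T_ideal] by (force simp: ev_add T_ideal_kernel)
      then show ?thesis by simp
    qed
    obtain f where f: "X = ?I +>\<^bsub>?A\<^esub> f"
      using X by (auto simp: T_algebra_def quotient_algebra_def T_ideal_def[symmetric] FactRing_def A_RCOSETS_def')
    have "?I +>\<^bsub>?A\<^esub> (free_const r * x) = ?I +>\<^bsub>?A\<^esub> (free_const r * f)" if "x \<in> X" for x
    proof -
      obtain i where i: "i \<in> ?I" "x = i + f" using \<open>x \<in> X\<close> by (auto simp: f coset)
      have "free_const r * x \<in> ?I +>\<^bsub>?A\<^esub> (free_const r * f)"
        unfolding coset i(2) distrib_left using ideal_free_algebraD(3)[OF ideal_T_ideal i(1)] by blast
      then show ?thesis by (intro I.a_repr_independence'[symmetric]) simp_all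
    qed
    moreover have "f \<in> X" unfolding f using I.a_rcos_self[of f] by simp
    ultimately have "(\<Union>x\<in>X. ?I +>\<^bsub>?A\<^esub> (free_const r * x)) = ?I +>\<^bsub>?A\<^esub> (free_const r * f)"
      by blast
    then have "r \<odot>\<^bsub>T_algebra \<alpha>1 \<alpha>2 \<alpha>3\<^esub> X = ?I +>\<^bsub>?A\<^esub> (free_const r * f)"
      by (simp add: T_algebra_def quotient_algebra_def T_ideal_def[symmetric] ring.defs module.defs)
    then show ?thesis by (simp only: val f ev_simps split_const_def to_mats_scal)
  qed
  ultimately show ?thesis by (simp add: algebra_iso_def)
qed

lemma semisimple_T_algebra: "semisimple (T_algebra \<alpha>1 \<alpha>2 \<alpha>3)"
  using T_algebra_iso semisimple_iso[OF ring_T_algebra ring_mat_square _ left_simple_frame_mat_square]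
  by (auto simp: algebra_iso_def)

end

section \<open>The four parameter regimes\<close>

lemma six_nonzero:
  assumes "CHAR('k::field) \<noteq> 2" "CHAR('k) \<noteq> 3"
  shows "(6::'k) \<noteq> 0"
proof -
  have "(of_nat n :: 'k) \<noteq> 0" if "prime n" "CHAR('k) \<noteq> n" for n
  proof
    assume "(of_nat n :: 'k) = 0"
    \<comment> \<open>The characteristic divides a prime, so it is that prime or 1, and 1 is
      impossible in a field.\<close>
    then have "CHAR('k) dvd n" by (simp add: of_nat_eq_0_iff_char_dvd)
    then show False using that CHAR_not_1' [where 'a = 'k] by (auto simp: prime_nat_iff)
  qed
  from this[of 2] this[of 3] have "(2::'k) \<noteq> 0" "(3::'k) \<noteq> 0" using assms by simp_all
  moreover have "(6::'k) = 2 * 3" by simp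
  ultimately show ?thesis by (metis mult_eq_0_iff)
qed

lemma cube_root_of_unity: "\<exists>\<omega>::'k::alg_closed_field. \<omega> * \<omega> = - 1 - \<omega>"
proof -
  obtain \<omega> :: 'k where "poly [:1, 1, 1:] \<omega> = 0"
    using alg_closed_imp_poly_has_root[of "[:1, 1, 1:] :: 'k poly"] by auto
  then show ?thesis by (intro exI[of _ \<omega>]) (simp add: algebra_simps eq_neg_iff_add_eq_0)
qed

lemma Split_simps [simp]:
  "Split a b + Split c d = Split (a + c) (b + d)" "Split a b - Split c d = Split (a - c) (b - d)"
  "- Split a b = Split (- a) (- b)" "Split a b * Split c d = Split (a * c) (b * d)"
  by (simp_all add: split_defs)

lemma not_semisimple_cubic_unit:
  fixes \<alpha>1 \<alpha>2 \<alpha>3 :: "'k::alg_closed_field"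
  assumes "(6::'k) \<noteq> 0" "\<alpha>3 \<noteq> 0" "\<alpha>3 + (\<alpha>1 + \<alpha>2) * (3 * \<alpha>1 - \<alpha>2)^2 = 0"
  shows "\<not> semisimple (T_algebra \<alpha>1 \<alpha>2 \<alpha>3)"
proof -
  obtain \<omega> :: 'k where \<omega>: "\<omega> * \<omega> = - 1 - \<omega>" using cube_root_of_unity by blast
  obtain \<mu> where \<mu>: "\<mu> ^ 3 = \<alpha>3" using nth_root_exists[of 3 \<alpha>3] by auto
  then have \<mu>0: "\<mu> \<noteq> 0" using assms(2) by auto
  define p q where "p = \<alpha>1 + \<alpha>2" and "q = 3 * \<alpha>1 - \<alpha>2"
  have d: "\<mu> ^ 3 + p * q^2 = 0" using assms(3) \<mu> by (simp add: p_def q_def)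
  \<comment> \<open>With \<open>l = \<mu>\<close> and \<open>t = 0\<close> the values of
    \<open>v\<close> and \<open>y\<close> are forced, and
    \<open>x^2 = \<delta> / \<mu>^2 = 0\<close> is solved by \<open>x = \<epsilon>\<close>.\<close>
  interpret tetra_rep_unit "\<lambda>r::'k. Dual r 0" \<alpha>1 \<alpha>2 \<alpha>3 \<omega> "Dual 0 1" "Dual (p * q / \<mu>^2) 0" 0 "Dual (p / \<mu>) 0" "Dual \<mu> 0" \<mu>
    apply unfold_locales
    using assms(1) \<omega> \<mu> \<mu>0 d
    apply (simp_all flip: p_def q_def add: dual_defs)
    apply (simp_all add: field_simps power2_eq_square power3_eq_cube)
    done
  show ?thesis by (rule not_semisimple_if_x_nilpotent) (simp_all add: dual_defs)
qed

lemma not_semisimple_cubic_zero: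
  fixes \<alpha>1 \<alpha>2 :: "'k::alg_closed_field"
  assumes "(6::'k) \<noteq> 0" "3 * \<alpha>1 - \<alpha>2 \<noteq> 0"
  shows "\<not> semisimple (T_algebra \<alpha>1 \<alpha>2 0)"
proof -
  obtain \<omega> :: 'k where \<omega>: "\<omega> * \<omega> = - 1 - \<omega>" using cube_root_of_unity by blast
  obtain t where t: "t ^ 2 = \<alpha>1 + \<alpha>2" using nth_root_exists[of 2 "\<alpha>1 + \<alpha>2"] by auto
  \<comment> \<open>With \<open>l = \<epsilon>\<close> and \<open>x = v = 0\<close>, the value
    \<open>y = - \<epsilon> / q\<close> solves \<open>y q + l = 0\<close>; the product
    \<open>l y\<close> vanishes and \<open>t^2 = p\<close> remains.\<close>
  interpret tetra_rep_alg "\<lambda>r::'k. Dual r 0" \<alpha>1 \<alpha>2 0 \<omega> 0 "Dual 0 (- 1 / (3 * \<alpha>1 - \<alpha>2))" "Dual t 0" 0 "Dual 0 1"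
    apply unfold_locales
    using assms \<omega> t by (simp_all add: dual_defs power2_eq_square)
  show ?thesis by (rule not_semisimple_if_l_nilpotent) (simp_all add: dual_defs)
qed

text \<open>Here all generators act by upper triangular matrices, and \<open>a - b\<close> by a strictly upper triangular one.\<close>

lemma not_semisimple_degenerate:
  fixes \<alpha>1 :: "'k::alg_closed_field"
  shows "\<not> semisimple (T_algebra \<alpha>1 (3 * \<alpha>1) 0)"
proof -
  obtain \<beta> where \<beta>: "\<beta> ^ 2 = \<alpha>1" using nth_root_exists[of 2 \<alpha>1] by auto
  define e where "e = (\<lambda>r::'k. Mat2 r 0 0 r)"
  \<comment> \<open>All diagonals are \<open>(\<beta>, -\<beta>)\<close>. In each relation
    containing \<open>a\<close>, it stands once on the left and once on the right of a product, so
    the off-diagonal entries cancel; \<open>cb + ba + ac - \<alpha>2\<close> becomes 0.\<close>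
  define g where "g = case_tetra_gen (Mat2 \<beta> 1 0 (- \<beta>)) (Mat2 \<beta> 0 0 (- \<beta>)) (Mat2 \<beta> 0 0 (- \<beta>)) (Mat2 \<beta> 0 0 (- \<beta>))"
  have \<beta>': "\<beta> * \<beta> = \<alpha>1" using \<beta> by (simp add: power2_eq_square)
  interpret T_evaluation e g \<alpha>1 "3 * \<alpha>1" 0
  proof unfold_locales
    show "r * e a = e a * r" for r a by (cases r) (simp add: e_def mult.commute)
    show "g u * g u = e \<alpha>1" for u by (cases u) (simp_all add: g_def e_def \<beta>')
  qed (simp_all add: e_def g_def \<beta>' one_mat2_def zero_mat2_def power3_eq_cube)
  have tri: "e21 (ev f) = 0" for f
  proof (induction f rule: free_alg_gen_induct)
    case (const c)
    show ?case unfolding ev_const by (simp add: e_def)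
  next
    case (gen f x)
    then show ?case unfolding ev_mult ev_gen by (cases x) (simp_all add: g_def times_mat2_def)
  next
    case (add f h)
    then show ?case by (simp add: ev_simps plus_mat2_def)
  qed
  have E: "ev (free_gen gen_a - free_gen gen_b) = Mat2 0 1 0 0"
    unfolding ev_diff ev_gen by (simp add: g_def)
  show ?thesis
  proof (rule not_semisimple_T[of "free_gen gen_a - free_gen gen_b"])
    show "ev (free_gen gen_a - free_gen gen_b) \<noteq> 0" unfolding E by (simp add: zero_mat2_def)
    fix r show "ev (free_gen gen_a - free_gen gen_b) * ev r * ev (free_gen gen_a - free_gen gen_b) = 0"
      unfolding E using tri[of r] by (cases "ev r") (simp add: zero_mat2_def)
  qed
qed

lemma semisimple_cubic_unit:
  fixes \<alpha>1 \<alpha>2 \<alpha>3 :: "'k::alg_closed_field"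
  assumes "(6::'k) \<noteq> 0" "\<alpha>3 \<noteq> 0" "\<alpha>3 + (\<alpha>1 + \<alpha>2) * (3 * \<alpha>1 - \<alpha>2)^2 \<noteq> 0"
  shows "semisimple (T_algebra \<alpha>1 \<alpha>2 \<alpha>3)"
    and "algebras_isomorphic (T_algebra \<alpha>1 \<alpha>2 \<alpha>3) (direct_product_algebra (matrix_algebra 6) (matrix_algebra 6))"
proof -
  obtain \<omega> :: 'k where \<omega>: "\<omega> * \<omega> = - 1 - \<omega>" using cube_root_of_unity by blast
  obtain \<mu> where \<mu>: "\<mu> ^ 3 = \<alpha>3" using nth_root_exists[of 3 \<alpha>3] by auto
  then have \<mu>0: "\<mu> \<noteq> 0" using assms(2) by auto
  define p q where "p = \<alpha>1 + \<alpha>2" and "q = 3 * \<alpha>1 - \<alpha>2"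
  obtain \<sigma> where "\<sigma> ^ 2 = \<alpha>3 + p * q ^ 2" using nth_root_exists[of 2 "\<alpha>3 + p * q ^ 2"] by auto
  then have \<sigma>: "\<sigma> ^ 2 = \<mu> ^ 3 + p * q ^ 2" and \<sigma>0: "\<sigma> \<noteq> 0" using assms(3) \<mu> by (auto simp: p_def q_def)
  \<comment> \<open>Each component is a representation over the field, one for each of the two
    square roots \<open>\<sigma>\<close> and \<open>-\<sigma>\<close> of
    \<open>\<delta>\<close>.\<close>
  interpret tetra_rep_unit "\<lambda>r::'k. Split r r" \<alpha>1 \<alpha>2 \<alpha>3 \<omega> "Split (\<sigma> / \<mu>) (- \<sigma> / \<mu>)"
    "Split (p * q / \<mu>^2) (p * q / \<mu>^2)" 0 "Split (p / \<mu>) (p / \<mu>)" "Split \<mu> \<mu>" \<mu>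
    apply unfold_locales
    using assms(1) \<omega> \<mu> \<mu>0 \<sigma>
    apply (simp_all flip: p_def q_def add: split_defs)
    apply (simp_all add: field_simps power2_eq_square power3_eq_cube)
    done
  have e: "e = split_const" by (simp add: e_def split_const_def fun_eq_iff)
  \<comment> \<open>The two components of \<open>x\<close> differ, so 1 and \<open>x\<close> span
    the pairs; \<open>a\<close> and \<open>b\<close> solve \<open>u = a + b \<sigma> / \<mu>\<close>
    and \<open>u' = a - b \<sigma> / \<mu>\<close>.\<close>
  have gen: "\<exists>a b. r = Split a a + Split b b * Split (\<sigma> / \<mu>) (- \<sigma> / \<mu>)" for r
  proof (cases r)
    case (Split u u')
    have "(4::'k) = 2 * 2" by simp
    then have "(4::'k) \<noteq> 0" using two by (metis mult_eq_0_iff)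
    then show ?thesis
      using two \<sigma>0 \<mu>0
      by (rule_tac x = "(u + u') / 2" in exI, rule_tac x = "(u - u') * \<mu> / (2 * \<sigma>)" in exI)
        (simp add: Split field_simps)
  qed
  have surj: "surj (word_eval split_const gens)"
    using surj_ev[OF gen, of "Split (\<mu> / \<sigma>) (- \<mu> / \<sigma>)"] \<sigma>0 \<mu>0 by (simp add: e split_defs)
  have eval: "T_evaluation split_const gens \<alpha>1 \<alpha>2 \<alpha>3" using T_evaluation_axioms unfolding e .
  show "semisimple (T_algebra \<alpha>1 \<alpha>2 \<alpha>3)" by (rule semisimple_T_algebra[OF eval surj])
  show "algebras_isomorphic (T_algebra \<alpha>1 \<alpha>2 \<alpha>3) (direct_product_algebra (matrix_algebra 6) (matrix_algebra 6))"
    using T_algebra_iso[OF eval surj] by (auto simp: algebras_isomorphic_def)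
qed

theorem theorem4p11:
  fixes \<alpha>1 \<alpha>2 \<alpha>3 :: "'k::alg_closed_field"
  assumes "CHAR('k) \<noteq> 2" and "CHAR('k) \<noteq> 3"
  shows "(semisimple (T_algebra \<alpha>1 \<alpha>2 \<alpha>3) \<longleftrightarrow>
            \<alpha>3 * (\<alpha>3 + (\<alpha>1 + \<alpha>2) * (3 * \<alpha>1 - \<alpha>2)^2) \<noteq> 0) \<and>
         (semisimple (T_algebra \<alpha>1 \<alpha>2 \<alpha>3) \<longrightarrow>
            algebras_isomorphic (T_algebra \<alpha>1 \<alpha>2 \<alpha>3)
              (direct_product_algebra (matrix_algebra 6) (matrix_algebra 6)))"
proof (cases "\<alpha>3 * (\<alpha>3 + (\<alpha>1 + \<alpha>2) * (3 * \<alpha>1 - \<alpha>2)^2) = 0")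
  case False
  then have "\<alpha>3 \<noteq> 0" "\<alpha>3 + (\<alpha>1 + \<alpha>2) * (3 * \<alpha>1 - \<alpha>2)^2 \<noteq> 0" by auto
  from semisimple_cubic_unit[OF six_nonzero[OF assms] this] False show ?thesis by blast
next
  case True
  \<comment> \<open>Three regimes: \<open>\<alpha>3 \<noteq> 0\<close>, where
    \<open>\<delta> = 0\<close>; \<open>\<alpha>3 = 0\<close> with \<open>q \<noteq> 0\<close>; and
    \<open>\<alpha>3 = q = 0\<close>.\<close>
  have "\<not> semisimple (T_algebra \<alpha>1 \<alpha>2 \<alpha>3)"
  proof (cases "\<alpha>3 = 0")
    case False
    then show ?thesis using True not_semisimple_cubic_unit[OF six_nonzero[OF assms]] by auto
  next
    case a3: True
    show ?thesis
    proof (cases "3 * \<alpha>1 - \<alpha>2 = 0")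
      case True
      then have "\<alpha>2 = 3 * \<alpha>1" by simp
      then show ?thesis using not_semisimple_degenerate[of \<alpha>1] a3 by simp
    next
      case False
      then show ?thesis using not_semisimple_cubic_zero[OF six_nonzero[OF assms] False] a3 by simp
    qed
  qed
  then show ?thesis using True by blast
qed

end
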